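(* For every $p\in(1,\infty)$ there exists $c_p\in(0,\infty)$ such that for every $n,d,m\in\mathbb{N}$ with $d+m\leq n$ and every function $f:\{-1,1\}^n\to\mathbb{C}$ of degree at most $d+m$ which is also in the $d$-th tail space, we have $$\|\nabla f\|_{L_p(\{-1,1\}^n;\mathbb{C})}\geq c_p\sqrt{\frac dm}\,\|f\|_{L_p(\{-1,1\}^n;\mathbb{C})}.$$
   Context: $\mathbb{N}=\{1,2,\ldots\}$. For $p\in[1,\infty)$, $\|f\|_{L_p(\{-1,1\}^n;\mathbb{C})}=\big(2^{-n}\sum_{\varepsilon\in\{-1,1\}^n}|f(\varepsilon)|^p\big)^{1/p}$. For $A\subseteq\{1,\ldots,n\}$, the Walsh function is $w_A(\varepsilon)=\prod_{i\in A}\varepsilon_i$. Every $f:\{-1,1\}^n\to\mathbb{C}$ has the expansion $f=\sum_{A}\widehat f(A)w_A$ with $\widehat f(A)=2^{-n}\sum_{\delta}f(\delta)w_A(\delta)$. A function $f$ has degree at most $k$ if $\widehat f(A)=0$ whenever $|A|>k$, and belongs to the $d$-th tail space if $\widehat f(A)=0$ whenever $|A|<d$. The partial derivatives are $\partial_if(\varepsilon)=\frac{f(\varepsilon)-f(\varepsilon_1,\ldots,\varepsilon_{i-1},-\varepsilon_i,\varepsilon_{i+1},\ldots,\varepsilon_n)}2$, and $\|\nabla f\|_{L_p(\{-1,1\}^n;\mathbb{C})}=\big\|\big(\sum_{i=1}^n|\partial_if|^2\big)^{1/2}\big\|_{L_p(\{-1,1\}^n;\mathbb{C})}$. *)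

theory Defs
  imports Complex_Main "HOL-Library.FuncSet"
begin

text \<open>Points of the cube are extensional functions on \<open>{1..n}\<close>, so that \<open>hypercube n\<close> is a finite
  set with \<open>2 ^ n\<close> elements. A function on the cube is a function on all of \<open>nat \<Rightarrow> real\<close>;
  the norms and coefficients below only depend on its values on \<open>hypercube n\<close>.\<close>

definition hypercube :: "nat \<Rightarrow> (nat \<Rightarrow> real) set" where
  "hypercube n = {1..n} \<rightarrow>\<^sub>E {-1, 1}"

definition Lp_norm :: "nat \<Rightarrow> real \<Rightarrow> ((nat \<Rightarrow> real) \<Rightarrow> 'a::real_normed_vector) \<Rightarrow> real" where
  "Lp_norm n p f = ((\<Sum>\<epsilon>\<in>hypercube n. norm (f \<epsilon>) powr p) / 2 ^ n) powr (1 / p)"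

definition walsh :: "nat set \<Rightarrow> (nat \<Rightarrow> real) \<Rightarrow> real" where
  "walsh A \<epsilon> = (\<Prod>i\<in>A. \<epsilon> i)"

definition walsh_coeff :: "nat \<Rightarrow> ((nat \<Rightarrow> real) \<Rightarrow> complex) \<Rightarrow> nat set \<Rightarrow> complex" where
  "walsh_coeff n f A = (\<Sum>\<delta>\<in>hypercube n. f \<delta> * of_real (walsh A \<delta>)) / 2 ^ n"

definition degree_at_most :: "nat \<Rightarrow> nat \<Rightarrow> ((nat \<Rightarrow> real) \<Rightarrow> complex) \<Rightarrow> bool" where
  "degree_at_most n k f \<longleftrightarrow> (\<forall>A\<subseteq>{1..n}. card A > k \<longrightarrow> walsh_coeff n f A = 0)"

definition in_tail_space :: "nat \<Rightarrow> nat \<Rightarrow> ((nat \<Rightarrow> real) \<Rightarrow> complex) \<Rightarrow> bool" where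
  "in_tail_space n d f \<longleftrightarrow> (\<forall>A\<subseteq>{1..n}. card A < d \<longrightarrow> walsh_coeff n f A = 0)"

definition partial_deriv :: "nat \<Rightarrow> ((nat \<Rightarrow> real) \<Rightarrow> complex) \<Rightarrow> (nat \<Rightarrow> real) \<Rightarrow> complex" where
  "partial_deriv i f \<epsilon> = (f \<epsilon> - f (\<epsilon>(i := - \<epsilon> i))) / 2"

definition grad_Lp_norm :: "nat \<Rightarrow> real \<Rightarrow> ((nat \<Rightarrow> real) \<Rightarrow> complex) \<Rightarrow> real" where
  "grad_Lp_norm n p f = Lp_norm n p (\<lambda>\<epsilon>. sqrt (\<Sum>i\<in>{1..n}. (norm (partial_deriv i f \<epsilon>))\<^sup>2))"

end

theory Submission
  imports Defs "HOL-Analysis.Convex" "HOL-Computational_Algebra.Polynomial"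
begin

text \<open>
  Write \<open>T\<^sub>r\<close> for the noise operator, which multiplies \<open>w\<^sub>A\<close> by \<open>r ^ card A\<close>; for \<open>0 \<le> r \<le> 1\<close> it
  averages against a probability kernel. Passing to real and imaginary parts, let \<open>f\<close> be real,
  with spectrum in \<open>[d, d + m]\<close>, let \<open>q\<close> be the exponent conjugate to \<open>p\<close>, and let \<open>g\<close> be the
  function of \<open>L\<^sub>q\<close> that norms \<open>f\<close>. The proof studies the single real function
  \<open>\<psi> r = E (f * T\<^sub>r g)\<close> on \<open>[0, 1]\<close>, whose value at 1 is the product of the two norms, and
  combines two facts.

  The first fact uses the spectrum. Here \<open>\<psi> r = r ^ d * P r\<close> with a polynomial \<open>P\<close> of degree at
  most \<open>m\<close>, and \<open>\<psi>\<close> is bounded by \<open>\<psi> 1\<close> since \<open>T\<^sub>r\<close> contracts. Such a function is small at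
  distances from 1 that are large multiples of \<open>m / d\<close>: Lagrange interpolation from nodes near 1
  loses a factor exponential in \<open>m\<close>, and \<open>(1 - K * m / d) ^ d\<close> gains \<open>exp (- K * m)\<close>. With \<open>K = 8\<close>
  this gives \<open>\<psi> (1 - 8 * m / d) \<le> \<psi> 1 / 2\<close> (\<open>polynomial_extrapolation\<close>) as long as \<open>8 * m \<le> d\<close>;
  for larger \<open>m\<close> the role of \<open>1 - 8 * m / d\<close> is played by 0, where \<open>\<psi>\<close> vanishes because \<open>d \<ge> 1\<close>.

  The second fact holds for all functions: \<open>\<psi> 1 - \<psi> s\<close> is at most a constant times \<open>sqrt (1 - s)\<close>
  times the \<open>L\<^sub>p\<close> norm of the gradient of \<open>f\<close> times the \<open>L\<^sub>q\<close> norm of \<open>g\<close> (\<open>noise_increment\<close>). At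
  \<open>s = 1 - 8 * m / d\<close> its right-hand side has the factor \<open>sqrt (m / d)\<close>, and the theorem follows.
  The two ranges of \<open>p\<close> need different arguments.

  For \<open>p \<le> 2\<close>, integration by parts in the kernel writes \<open>(1 - r\<^sup>2) * \<psi>' r\<close> as the expectation of
  \<open>g \<epsilon>\<close> times \<open>\<Sum>i. (\<epsilon>\<^sub>i * \<delta>\<^sub>i - r) * \<partial>\<^sub>i f \<delta>\<close> over \<open>r\<close>-correlated pairs \<open>(\<epsilon>, \<delta>)\<close>. Given \<open>\<delta>\<close>, the
  random variables \<open>\<epsilon>\<^sub>i * \<delta>\<^sub>i - r\<close> are centred, orthogonal and of variance \<open>1 - r\<^sup>2\<close>, so for
  \<open>p \<le> 2\<close> the conditional \<open>p\<close>-th moment is controlled by the length of the gradient.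

  For \<open>p > 2\<close> these variables are too heavy-tailed, and the argument is that of Stein for
  Littlewood-Paley functions. One may take \<open>g\<close> positive. With \<open>u = T\<^sub>r g\<close>, the form
  \<open>E (\<Sum>i. \<partial>\<^sub>i f * \<partial>\<^sub>i u)\<close>, which equals \<open>r * \<psi>' r\<close>, only needs those edges of the cube seen from
  the endpoint where \<open>u\<close> is larger; there \<open>u powr (q - 2) * (\<partial>\<^sub>i u)\<^sup>2\<close> is dominated by
  \<open>\<partial>\<^sub>i u * \<partial>\<^sub>i (u powr (q - 1))\<close>, whose sum over \<open>i\<close> has mean proportional to the derivative of
  \<open>\<phi> r = E (u powr q)\<close>. Integrating over \<open>r\<close> and using Cauchy-Schwarz gives the factor
  \<open>sqrt (1 - s)\<close>; near \<open>r = 0\<close>, where \<open>dr / r\<close> is not integrable, the power decay of \<open>\<phi> r - \<phi> 0\<close>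
  that follows from a Beckner inequality takes over.
\<close>

section \<open>Inequalities for powers and weighted sums\<close>

lemma conjugate_exponent_gt_one:
  fixes p q :: real
  assumes "1 < p" "1 / p + 1 / q = 1"
  shows "1 < q"
proof -
  have "0 < 1 / p" "1 / p < 1" using assms(1) by auto
  then have "0 < 1 / q" "1 / q < 1" using assms(2) by linarith+
  then show ?thesis by simp
qed

lemma conjugate_exponent_lt_two:
  fixes p q :: real
  assumes "2 < p" "1 / p + 1 / q = 1"
  shows "q < 2"
proof -
  have "1 / p < 1 / 2" using assms(1) by (simp add: field_simps)
  then have "1 / q > 1 / 2" using assms(2) by linarith
  moreover have "1 < q" using conjugate_exponent_gt_one[OF _ assms(2)] assms(1) by simp
  ultimately show ?thesis by (simp add: field_simps)
qed

lemma weighted_Holder: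
  fixes w x y :: "'a \<Rightarrow> real"
  assumes "finite I" and nonneg: "\<And>i. i \<in> I \<Longrightarrow> 0 \<le> w i" "\<And>i. i \<in> I \<Longrightarrow> 0 \<le> x i"
    "\<And>i. i \<in> I \<Longrightarrow> 0 \<le> y i"
    and pq: "1 < p" "1 < q" "1 / p + 1 / q = 1"
  shows "(\<Sum>i\<in>I. w i * (x i * y i))
    \<le> (\<Sum>i\<in>I. w i * x i powr p) powr (1 / p) * (\<Sum>i\<in>I. w i * y i powr q) powr (1 / q)"
proof -
  define X where "X = (\<Sum>i\<in>I. w i * x i powr p)"
  define Y where "Y = (\<Sum>i\<in>I. w i * y i powr q)"
  have X0: "X \<ge> 0" and Y0: "Y \<ge> 0"
    unfolding X_def Y_def using nonneg by (auto intro!: sum_nonneg mult_nonneg_nonneg)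
  have zero: "(\<Sum>i\<in>I. w i * (x i * y i)) = 0" if "X = 0 \<or> Y = 0"
  proof (intro sum.neutral ballI)
    fix i assume i: "i \<in> I"
    from that have "w i * x i powr p = 0 \<or> w i * y i powr q = 0"
    proof
      assume "X = 0"
      then have "\<forall>i\<in>I. w i * x i powr p = 0"
        unfolding X_def using assms(1) nonneg by (subst (asm) sum_nonneg_eq_0_iff) auto
      then show ?thesis using i by blast
    next
      assume "Y = 0"
      then have "\<forall>i\<in>I. w i * y i powr q = 0"
        unfolding Y_def using assms(1) nonneg by (subst (asm) sum_nonneg_eq_0_iff) auto
      then show ?thesis using i by blast
    qed
    then show "w i * (x i * y i) = 0" by auto
  qed
  show ?thesis
  proof (cases "X = 0 \<or> Y = 0")
    case True
    then show ?thesis using zero by simp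
  next
    case False
    then have Xp: "X > 0" and Yp: "Y > 0" using X0 Y0 by auto
    \<comment> \<open>normalising both factors to norm one reduces the claim to the inequality of Young, term by
        term\<close>
    define a where "a = X powr (1 / p)"
    define b where "b = Y powr (1 / q)"
    have ab: "a > 0" "b > 0" using Xp Yp by (auto simp: a_def b_def)
    have ap: "a powr p = X" and bq: "b powr q = Y"
      using pq Xp Yp by (auto simp: a_def b_def powr_powr)
    have "(\<Sum>i\<in>I. w i * (x i / a * (y i / b)))
        \<le> (\<Sum>i\<in>I. w i * ((x i / a) powr p / p + (y i / b) powr q / q))"
      using nonneg ab pq
      by (intro sum_mono mult_left_mono Youngs_inequality) (auto intro: divide_nonneg_pos)
    also have "\<dots> = (\<Sum>i\<in>I. w i * x i powr p / (X * p) + w i * y i powr q / (Y * q))"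
      using nonneg ab
      by (intro sum.cong refl) (simp add: powr_divide ap bq divide_simps, simp add: algebra_simps)
    also have "\<dots> = 1 / p + 1 / q"
      using Xp Yp by (simp add: sum.distrib flip: sum_divide_distrib X_def Y_def)
    also have "\<dots> = 1" by (rule pq)
    finally have "(\<Sum>i\<in>I. w i * (x i * y i)) / (a * b) \<le> 1"
      by (simp add: sum_divide_distrib)
    then show ?thesis using ab by (simp add: divide_simps flip: X_def Y_def a_def b_def)
  qed
qed

lemma weighted_power_mean:
  fixes w x :: "'a \<Rightarrow> real"
  assumes "finite I" and nonneg: "\<And>i. i \<in> I \<Longrightarrow> 0 \<le> w i" "\<And>i. i \<in> I \<Longrightarrow> 0 \<le> x i"
    and tot: "(\<Sum>i\<in>I. w i) = 1" and ab: "0 < a" "a \<le> b"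
  shows "(\<Sum>i\<in>I. w i * x i powr a) \<le> (\<Sum>i\<in>I. w i * x i powr b) powr (a / b)"
proof (cases "a = b")
  case True
  have "0 \<le> (\<Sum>i\<in>I. w i * x i powr b)" using nonneg by (auto intro!: sum_nonneg)
  then show ?thesis using True ab by simp
next
  case False
  define q where "q = b / (b - a)"
  have q: "1 < b / a" "1 < q" "1 / (b / a) + 1 / q = 1"
    using ab False by (auto simp: q_def field_simps)
  have "(\<Sum>i\<in>I. w i * (x i powr a * 1))
     \<le> (\<Sum>i\<in>I. w i * (x i powr a) powr (b / a)) powr (1 / (b / a))
       * (\<Sum>i\<in>I. w i * 1 powr q) powr (1 / q)"
    using nonneg q by (intro weighted_Holder assms(1)) auto
  then show ?thesis using ab tot by (simp add: powr_powr)
qed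

lemma powr_add_le:
  fixes a b q :: real
  assumes "0 \<le> a" "0 \<le> b" "0 < q"
  shows "(a + b) powr q \<le> 2 powr q * (a powr q + b powr q)"
proof -
  have "(a + b) powr q \<le> (2 * max a b) powr q" using assms by (intro powr_mono2) auto
  also have "\<dots> = 2 powr q * max a b powr q" using assms by (simp add: powr_mult)
  also have "\<dots> \<le> 2 powr q * (a powr q + b powr q)" by (intro mult_left_mono) (auto simp: max_def)
  finally show ?thesis .
qed

text \<open>Concavity of \<open>x powr (q - 1)\<close>: the tangent at \<open>a\<close> lies above the graph. The slope
  \<open>a powr (q - 2)\<close> is taken at \<open>a\<close>, which will always be the larger of two neighbouring values.\<close>

lemma powr_diff_ge_tangent:
  fixes a b :: real
  assumes q: "1 < q" "q \<le> 2" and ab: "0 < a" "0 < b"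
  shows "(q - 1) * (a powr (q - 2) * (a - b)) \<le> a powr (q - 1) - b powr (q - 1)"
proof -
  have "b powr (q - 1) * a powr (2 - q) \<le> (q - 1) * b + (2 - q) * a"
    using q ab by (intro Youngs_inequality_0) auto
  then have "a powr (q - 2) * (b powr (q - 1) * a powr (2 - q)) \<le> a powr (q - 2) * ((q - 1) * b
      + (2 - q) * a)"
    by (intro mult_left_mono) auto
  moreover have "a powr (q - 2) * a powr (2 - q) = 1" using ab by (simp flip: powr_add)
  then have "a powr (q - 2) * (b powr (q - 1) * a powr (2 - q)) = b powr (q - 1)"
    by (metis mult.left_commute mult.right_neutral)
  ultimately have "b powr (q - 1) \<le> a powr (q - 2) * ((q - 1) * b + (2 - q) * a)" by simp
  moreover have "a powr (q - 1) = a powr (q - 2) * a"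
    using ab powr_add[of a "q - 2" 1] by simp
  ultimately show ?thesis by (simp add: algebra_simps)
qed

text \<open>An edgewise form of the chain rule, comparing the gradient of \<open>u powr (q / 2)\<close> with the form
  that differentiates \<open>u powr q\<close>; it feeds the Poincare inequality in \<open>cube_beckner\<close>.\<close>

lemma powr_sq_diff_le:
  fixes a b :: real
  assumes q: "1 < q" "q \<le> 2" and ab: "0 < b" "b \<le> a"
  shows "(q - 1) * (a powr (q / 2) - b powr (q / 2))\<^sup>2 \<le> (a - b) * (a powr (q - 1) - b powr (q - 1))"
proof -
  have "b powr (q / 2) = b powr (q / 2 - 1) * b"
    using ab powr_add[of b "q / 2 - 1" 1] by simp
  moreover have "a powr (q / 2 - 1) * b \<le> b powr (q / 2 - 1) * b"
    using ab q by (intro mult_right_mono powr_mono2') auto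
  moreover have "a powr (q / 2) = a powr (q / 2 - 1) * a"
    using ab powr_add[of a "q / 2 - 1" 1] by simp
  ultimately have "a powr (q / 2) - b powr (q / 2) \<le> a powr (q / 2 - 1) * (a - b)"
    by (simp add: algebra_simps)
  moreover have "0 \<le> a powr (q / 2) - b powr (q / 2)"
    using ab q by (simp add: powr_mono2)
  ultimately have "(a powr (q / 2) - b powr (q / 2))\<^sup>2 \<le> (a powr (q / 2 - 1) * (a - b))\<^sup>2"
    by (intro power_mono) auto
  also have "\<dots> = (a - b) * (a powr (q - 2) * (a - b))"
    using ab by (simp add: power2_eq_square mult_ac powr_add[symmetric] flip: mult.assoc)
  finally have "(q - 1) * (a powr (q / 2) - b powr (q / 2))\<^sup>2
      \<le> (q - 1) * ((a - b) * (a powr (q - 2) * (a - b)))"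
    using q by (intro mult_left_mono) auto
  also have "\<dots> = (a - b) * ((q - 1) * (a powr (q - 2) * (a - b)))" by simp
  also have "\<dots> \<le> (a - b) * (a powr (q - 1) - b powr (q - 1))"
    using q ab by (intro mult_left_mono powr_diff_ge_tangent) auto
  finally show ?thesis .
qed

lemma powr_sq_diff_le':
  fixes a b :: real
  assumes q: "1 < q" "q \<le> 2" and ab: "0 < b" "0 < a"
  shows "(q - 1) * (a powr (q / 2) - b powr (q / 2))\<^sup>2 \<le> (a - b) * (a powr (q - 1) - b powr (q - 1))"
proof (cases "b \<le> a")
  case True
  then show ?thesis using powr_sq_diff_le[OF q ab(1)] by simp
next
  case False
  then show ?thesis using powr_sq_diff_le[OF q ab(2), of b]
    by (simp add: power2_commute algebra_simps)
qed

text \<open>Lets a bound proved with a strictly larger, hence nonzero, quantity be used when the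
  quantity itself may be zero.\<close>

lemma le_mult_if_le_mult_greater:
  fixes c x z :: real
  assumes "\<And>y. x < y \<Longrightarrow> z \<le> c * y" and "0 \<le> c"
  shows "z \<le> c * x"
proof (cases "c = 0")
  case True
  then show ?thesis using assms(1)[of "x + 1"] by simp
next
  case False
  then have c: "c > 0" using assms(2) by simp
  have "z / c \<le> x"
    by (rule dense_ge) (use assms(1) c in \<open>simp add: pos_divide_le_eq mult.commute\<close>)
  then show ?thesis using c by (simp add: pos_divide_le_eq mult.commute)
qed

section \<open>Averages and discrete derivatives on the cube\<close>

definition cube_avg :: "nat \<Rightarrow> ((nat \<Rightarrow> real) \<Rightarrow> real) \<Rightarrow> real" where
  "cube_avg n f = (\<Sum>\<epsilon>\<in>hypercube n. f \<epsilon>) / 2 ^ n"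

definition flip :: "nat \<Rightarrow> (nat \<Rightarrow> real) \<Rightarrow> nat \<Rightarrow> real" where
  "flip i \<epsilon> = \<epsilon>(i := - \<epsilon> i)"

definition discrete_deriv :: "nat \<Rightarrow> ((nat \<Rightarrow> real) \<Rightarrow> real) \<Rightarrow> (nat \<Rightarrow> real) \<Rightarrow> real" where
  "discrete_deriv i f \<epsilon> = (f \<epsilon> - f (flip i \<epsilon>)) / 2"

definition fourier_coeff :: "nat \<Rightarrow> ((nat \<Rightarrow> real) \<Rightarrow> real) \<Rightarrow> nat set \<Rightarrow> real" where
  "fourier_coeff n f A = cube_avg n (\<lambda>\<epsilon>. f \<epsilon> * walsh A \<epsilon>)"

lemma finite_hypercube [simp]: "finite (hypercube n)"
  unfolding hypercube_def by (intro finite_PiE) auto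

lemma hypercube_coord: "\<epsilon> \<in> hypercube n \<Longrightarrow> i \<in> {1..n} \<Longrightarrow> \<epsilon> i = 1 \<or> \<epsilon> i = -1"
  unfolding hypercube_def by (auto simp: PiE_def Pi_def)

lemma hypercube_coord_sq: "\<epsilon> \<in> hypercube n \<Longrightarrow> i \<in> {1..n} \<Longrightarrow> \<epsilon> i * \<epsilon> i = 1"
  using hypercube_coord by fastforce

lemma sum_hypercube_prod:
  "(\<Sum>\<epsilon>\<in>hypercube n. \<Prod>i\<in>{1..n}. h i (\<epsilon> i)) = (\<Prod>i\<in>{1..n}. h i 1 + h i (-1) :: real)"
proof -
  have "(\<Prod>i\<in>{1..n}. \<Sum>x\<in>{-1,1}. h i x) = (\<Sum>\<epsilon>\<in>hypercube n. \<Prod>i\<in>{1..n}. h i (\<epsilon> i))"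
    unfolding hypercube_def by (rule prod_sum_PiE) auto
  then show ?thesis by (simp add: add.commute)
qed

lemma card_hypercube: "real (card (hypercube n)) = 2 ^ n"
  using sum_hypercube_prod[of "\<lambda>_ _. 1" n] by simp

lemma cube_avg_cong:
  "(\<And>\<epsilon>. \<epsilon> \<in> hypercube n \<Longrightarrow> f \<epsilon> = g \<epsilon>) \<Longrightarrow> cube_avg n f = cube_avg n g"
  by (simp add: cube_avg_def)

lemma cube_avg_mono:
  "(\<And>\<epsilon>. \<epsilon> \<in> hypercube n \<Longrightarrow> f \<epsilon> \<le> g \<epsilon>) \<Longrightarrow> cube_avg n f \<le> cube_avg n g"
  by (simp add: cube_avg_def divide_right_mono sum_mono)

lemma cube_avg_nonneg:
  "(\<And>\<epsilon>. \<epsilon> \<in> hypercube n \<Longrightarrow> 0 \<le> f \<epsilon>) \<Longrightarrow> 0 \<le> cube_avg n f"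
  by (simp add: cube_avg_def sum_nonneg)

lemma cube_avg_const [simp]: "cube_avg n (\<lambda>_. c) = c"
  by (simp add: cube_avg_def card_hypercube)

lemma cube_avg_add: "cube_avg n (\<lambda>\<epsilon>. f \<epsilon> + g \<epsilon>) = cube_avg n f + cube_avg n g"
  by (simp add: cube_avg_def sum.distrib add_divide_distrib)

lemma cube_avg_diff: "cube_avg n (\<lambda>\<epsilon>. f \<epsilon> - g \<epsilon>) = cube_avg n f - cube_avg n g"
  by (simp add: cube_avg_def sum_subtractf diff_divide_distrib)

lemma cube_avg_cmult: "cube_avg n (\<lambda>\<epsilon>. c * f \<epsilon>) = c * cube_avg n f"
  by (simp add: cube_avg_def sum_distrib_left)

lemma cube_avg_sum: "cube_avg n (\<lambda>\<epsilon>. \<Sum>i\<in>I. f i \<epsilon>) = (\<Sum>i\<in>I. cube_avg n (f i))"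
  unfolding cube_avg_def by (subst sum.swap) (simp add: sum_divide_distrib)

lemma flip_flip [simp]: "flip i (flip i \<epsilon>) = \<epsilon>"
  by (simp add: flip_def)

lemma flip_in_hypercube: "\<epsilon> \<in> hypercube n \<Longrightarrow> i \<in> {1..n} \<Longrightarrow> flip i \<epsilon> \<in> hypercube n"
  by (fastforce simp: flip_def hypercube_def PiE_def Pi_def extensional_def)

lemma cube_avg_flip:
  assumes "i \<in> {1..n}"
  shows "cube_avg n (\<lambda>\<epsilon>. f (flip i \<epsilon>)) = cube_avg n f"
proof -
  have "(\<Sum>\<epsilon>\<in>hypercube n. f (flip i \<epsilon>)) = (\<Sum>\<epsilon>\<in>hypercube n. f \<epsilon>)"
    by (rule sum.reindex_bij_witness[of _ "flip i" "flip i"])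
       (use assms flip_in_hypercube in auto)
  then show ?thesis by (simp add: cube_avg_def)
qed

lemma discrete_deriv_flip: "discrete_deriv i f (flip i \<epsilon>) = - discrete_deriv i f \<epsilon>"
  by (simp add: discrete_deriv_def diff_divide_distrib)

section \<open>The noise operator in Walsh coordinates\<close>

text \<open>The conditional law of \<open>\<delta>\<close> given \<open>\<epsilon>\<close> when the coordinates \<open>\<epsilon>\<^sub>i * \<delta>\<^sub>i\<close> are independent signs
  of mean \<open>r\<close>.\<close>

definition noise_kernel :: "nat \<Rightarrow> real \<Rightarrow> (nat \<Rightarrow> real) \<Rightarrow> (nat \<Rightarrow> real) \<Rightarrow> real" where
  "noise_kernel n r \<epsilon> \<delta> = (\<Prod>i\<in>{1..n}. (1 + r * \<epsilon> i * \<delta> i) / 2)"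

definition noise :: "nat \<Rightarrow> real \<Rightarrow> ((nat \<Rightarrow> real) \<Rightarrow> real) \<Rightarrow> (nat \<Rightarrow> real) \<Rightarrow> real" where
  "noise n r f \<epsilon> = (\<Sum>\<delta>\<in>hypercube n. noise_kernel n r \<epsilon> \<delta> * f \<delta>)"

lemma walsh_as_full_prod:
  assumes "A \<subseteq> {1..n}"
  shows "walsh A \<epsilon> = (\<Prod>i\<in>{1..n}. if i \<in> A then \<epsilon> i else 1)"
  using assms by (simp add: walsh_def prod.If_cases Int_absorb1)

lemma noise_kernel_walsh:
  assumes "A \<subseteq> {1..n}" "\<delta> \<in> hypercube n"
  shows "(\<Sum>\<epsilon>\<in>hypercube n. noise_kernel n r \<epsilon> \<delta> * walsh A \<epsilon>) = r ^ card A * walsh A \<delta>"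
proof -
  have "(\<Sum>\<epsilon>\<in>hypercube n. noise_kernel n r \<epsilon> \<delta> * walsh A \<epsilon>)
     = (\<Sum>\<epsilon>\<in>hypercube n. \<Prod>i\<in>{1..n}. (1 + r * \<epsilon> i * \<delta> i) / 2 * (if i \<in> A then \<epsilon> i else 1))"
    by (simp only: noise_kernel_def walsh_as_full_prod[OF assms(1)] prod.distrib)
  also have "\<dots> = (\<Prod>i\<in>{1..n}. (1 + r * \<delta> i) / 2 * (if i \<in> A then 1 else 1)
        + (1 + r * (-1) * \<delta> i) / 2 * (if i \<in> A then -1 else 1))"
    by (subst sum_hypercube_prod) simp
  also have "\<dots> = (\<Prod>i\<in>{1..n}. if i \<in> A then r * \<delta> i else 1)"
    by (intro prod.cong) (auto simp: field_simps)
  also have "\<dots> = r ^ card A * walsh A \<delta>"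
    using assms(1) by (simp add: walsh_def prod.If_cases Int_absorb1 prod.distrib)
  finally show ?thesis .
qed

lemma noise_kernel_expansion:
  "noise_kernel n r \<epsilon> \<delta> = (\<Sum>A\<in>Pow {1..n}. r ^ card A * walsh A \<epsilon> * walsh A \<delta>) / 2 ^ n"
proof -
  have "noise_kernel n r \<epsilon> \<delta> = (\<Prod>i\<in>{1..n}. r * \<epsilon> i * \<delta> i + 1) / 2 ^ n"
    by (simp add: noise_kernel_def prod_dividef add.commute)
  also have "(\<Prod>i\<in>{1..n}. r * \<epsilon> i * \<delta> i + 1) = (\<Sum>A\<in>Pow {1..n}. \<Prod>i\<in>A. r * \<epsilon> i * \<delta> i)"
    by (subst prod_add) auto
  also have "\<dots> = (\<Sum>A\<in>Pow {1..n}. r ^ card A * walsh A \<epsilon> * walsh A \<delta>)"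
    by (simp add: walsh_def prod.distrib)
  finally show ?thesis .
qed

lemma noise_kernel_commute: "noise_kernel n r \<epsilon> \<delta> = noise_kernel n r \<delta> \<epsilon>"
  by (simp add: noise_kernel_def mult_ac)

lemma noise_kernel_nonneg:
  assumes "\<epsilon> \<in> hypercube n" "\<delta> \<in> hypercube n" "0 \<le> r" "r \<le> 1"
  shows "0 \<le> noise_kernel n r \<epsilon> \<delta>"
  unfolding noise_kernel_def
proof (intro prod_nonneg)
  fix i assume "i \<in> {1..n}"
  then have "(\<epsilon> i = 1 \<or> \<epsilon> i = -1) \<and> (\<delta> i = 1 \<or> \<delta> i = -1)"
    using assms hypercube_coord by blast
  then show "0 \<le> (1 + r * \<epsilon> i * \<delta> i) / 2" using assms by auto
qed

lemma sum_noise_kernel: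
  "\<delta> \<in> hypercube n \<Longrightarrow> (\<Sum>\<epsilon>\<in>hypercube n. noise_kernel n r \<epsilon> \<delta>) = 1"
  using noise_kernel_walsh[of "{}" n \<delta> r] by (simp add: walsh_def)

lemma sum_noise_kernel':
  "\<delta> \<in> hypercube n \<Longrightarrow> (\<Sum>\<epsilon>\<in>hypercube n. noise_kernel n r \<delta> \<epsilon>) = 1"
  using sum_noise_kernel by (simp add: noise_kernel_commute[of n r \<delta>])

text \<open>For extreme correlation the kernel is the identity, so facts about \<open>noise\<close> at \<open>r = 1\<close> become
  facts about functions themselves; Parseval is obtained in this way.\<close>

lemma noise_kernel_one:
  assumes "\<epsilon> \<in> hypercube n" "\<delta> \<in> hypercube n"
  shows "noise_kernel n 1 \<epsilon> \<delta> = of_bool (\<delta> = \<epsilon>)"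
proof (cases "\<delta> = \<epsilon>")
  case True
  have "noise_kernel n 1 \<epsilon> \<epsilon> = (\<Prod>i\<in>{1..n}. 1)"
    unfolding noise_kernel_def
    by (intro prod.cong refl) (simp add: hypercube_coord_sq[OF assms(1)] mult.assoc)
  with True show ?thesis by simp
next
  case False
  then obtain i where i: "i \<in> {1..n}" "\<delta> i \<noteq> \<epsilon> i"
    using assms unfolding hypercube_def by (meson PiE_ext)
  then have "\<epsilon> i * \<delta> i = -1"
    using hypercube_coord[OF assms(1) i(1)] hypercube_coord[OF assms(2) i(1)] by auto
  with i show ?thesis using False by (auto simp: noise_kernel_def intro!: bexI[of _ i])
qed

lemma noise_one: "\<epsilon> \<in> hypercube n \<Longrightarrow> noise n 1 f \<epsilon> = f \<epsilon>"
  by (simp add: noise_def noise_kernel_one sum.delta' of_bool_def if_distrib[of "\<lambda>x. x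
      * _"] cong: if_cong)

lemma noise_zero: "noise n 0 g \<epsilon> = cube_avg n g"
  by (simp add: noise_def noise_kernel_def cube_avg_def power_one_over sum_divide_distrib)

lemma noise_pos:
  assumes pos: "\<And>\<epsilon>. \<epsilon> \<in> hypercube n \<Longrightarrow> 0 < g \<epsilon>"
    and r: "0 \<le> r" "r \<le> 1" and e: "\<epsilon> \<in> hypercube n"
  shows "0 < noise n r g \<epsilon>"
proof -
  have nn: "0 \<le> noise_kernel n r \<epsilon> \<delta> * g \<delta>" if "\<delta> \<in> hypercube n" for \<delta>
    using that e r pos by (auto intro!: mult_nonneg_nonneg noise_kernel_nonneg simp: less_imp_le)
  have "noise n r g \<epsilon> \<noteq> 0"
  proof
    assume "noise n r g \<epsilon> = 0"
    then have "\<forall>\<delta>\<in>hypercube n. noise_kernel n r \<epsilon> \<delta> * g \<delta> = 0"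
      unfolding noise_def using nn by (subst (asm) sum_nonneg_eq_0_iff) auto
    then have "\<forall>\<delta>\<in>hypercube n. noise_kernel n r \<epsilon> \<delta> = 0" using pos by force
    then show False using sum_noise_kernel'[OF e, of r] by simp
  qed
  moreover have "0 \<le> noise n r g \<epsilon>" unfolding noise_def by (intro sum_nonneg nn)
  ultimately show ?thesis by simp
qed

lemma noise_diff: "noise n r (\<lambda>\<epsilon>. g \<epsilon> - h \<epsilon>) \<epsilon> = noise n r g \<epsilon> - noise n r h \<epsilon>"
  by (simp add: noise_def algebra_simps sum_subtractf)

lemma noise_walsh_expansion:
  "noise n r f \<epsilon> = (\<Sum>A\<in>Pow {1..n}. r ^ card A * fourier_coeff n f A * walsh A \<epsilon>)"
  unfolding noise_def noise_kernel_expansion fourier_coeff_def cube_avg_def sum_divide_distrib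
    sum_distrib_left sum_distrib_right
  by (subst sum.swap) (simp add: mult_ac)

lemma cube_avg_noise:
  "cube_avg n (\<lambda>\<epsilon>. f \<epsilon> * noise n r g \<epsilon>)
   = (\<Sum>A\<in>Pow {1..n}. r ^ card A * (fourier_coeff n f A * fourier_coeff n g A))"
  unfolding noise_walsh_expansion
  unfolding fourier_coeff_def[of n f] cube_avg_def sum_divide_distrib
    sum_distrib_left sum_distrib_right
  by (subst sum.swap) (simp add: mult_ac)

lemma parseval:
  "cube_avg n (\<lambda>\<epsilon>. f \<epsilon> * g \<epsilon>) = (\<Sum>A\<in>Pow {1..n}. fourier_coeff n f A * fourier_coeff n g A)"
proof -
  have "cube_avg n (\<lambda>\<epsilon>. f \<epsilon> * g \<epsilon>) = cube_avg n (\<lambda>\<epsilon>. f \<epsilon> * noise n 1 g \<epsilon>)"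
    by (intro cube_avg_cong) (simp add: noise_one)
  then show ?thesis by (simp add: cube_avg_noise)
qed

lemma fourier_noise:
  assumes "A \<subseteq> {1..n}"
  shows "fourier_coeff n (noise n r f) A = r ^ card A * fourier_coeff n f A"
proof -
  have "(\<Sum>\<epsilon>\<in>hypercube n. noise n r f \<epsilon> * walsh A \<epsilon>)
      = (\<Sum>\<delta>\<in>hypercube n. f \<delta> * (\<Sum>\<epsilon>\<in>hypercube n. noise_kernel n r \<epsilon> \<delta> * walsh A \<epsilon>))"
    unfolding noise_def sum_distrib_left sum_distrib_right
    by (subst sum.swap) (simp add: mult_ac)
  also have "\<dots> = r ^ card A * (\<Sum>\<delta>\<in>hypercube n. f \<delta> * walsh A \<delta>)"
    by (subst sum_distrib_left, intro sum.cong refl) (simp add: noise_kernel_walsh[OF assms])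
  finally show ?thesis by (simp add: fourier_coeff_def cube_avg_def)
qed

lemma walsh_flip:
  assumes "finite A"
  shows "walsh A (flip i \<epsilon>) = (if i \<in> A then - walsh A \<epsilon> else walsh A \<epsilon>)"
proof (cases "i \<in> A")
  case True
  then have "walsh A (flip i \<epsilon>) = (- \<epsilon> i) * (\<Prod>j\<in>A - {i}. \<epsilon> j)"
    using assms by (auto simp: walsh_def prod.remove[of A i] flip_def)
  then show ?thesis using True assms by (simp add: walsh_def prod.remove[of A i])
next
  case False
  then have "walsh A (flip i \<epsilon>) = walsh A \<epsilon>"
    unfolding walsh_def flip_def by (intro prod.cong) auto
  with False show ?thesis by simp
qed

lemma fourier_discrete_deriv:
  assumes "i \<in> {1..n}" "A \<subseteq> {1..n}"
  shows "fourier_coeff n (discrete_deriv i f) A = (if i \<in> A then fourier_coeff n f A else 0)"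
proof -
  have fin: "finite A" using assms(2) finite_subset by blast
  have "cube_avg n (\<lambda>\<epsilon>. f (flip i \<epsilon>) * walsh A \<epsilon>)
      = cube_avg n (\<lambda>\<epsilon>. f (flip i (flip i \<epsilon>)) * walsh A (flip i \<epsilon>))"
    by (rule cube_avg_flip[OF assms(1), symmetric])
  also have "\<dots> = (if i \<in> A then - 1 else 1) * fourier_coeff n f A"
    unfolding fourier_coeff_def cube_avg_cmult[symmetric] by (intro cube_avg_cong)
        (simp add: walsh_flip fin)
  finally have flipped: "cube_avg n (\<lambda>\<epsilon>. f (flip i \<epsilon>) * walsh A \<epsilon>)
      = (if i \<in> A then - 1 else 1) * fourier_coeff n f A" .
  have "fourier_coeff n (discrete_deriv i f) A
      = cube_avg n (\<lambda>\<epsilon>. (1/2) * (f \<epsilon> * walsh A \<epsilon> - f (flip i \<epsilon>) * walsh A \<epsilon>))"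
    unfolding fourier_coeff_def by (intro cube_avg_cong) (simp add: discrete_deriv_def field_simps)
  also have "\<dots> = (1/2) * (fourier_coeff n f A - cube_avg n (\<lambda>\<epsilon>. f (flip i \<epsilon>) * walsh A \<epsilon>))"
    unfolding cube_avg_cmult cube_avg_diff by (simp add: fourier_coeff_def)
  finally show ?thesis unfolding flipped by (auto simp: field_simps)
qed

text \<open>The Dirichlet form of the cube: the mean of \<open>f\<close> times the number operator applied to \<open>g\<close>.\<close>

definition energy :: "nat \<Rightarrow> ((nat \<Rightarrow> real) \<Rightarrow> real) \<Rightarrow> ((nat \<Rightarrow> real) \<Rightarrow> real) \<Rightarrow> real" where
  "energy n f g = cube_avg n (\<lambda>\<epsilon>. \<Sum>i\<in>{1..n}. discrete_deriv i f \<epsilon> * discrete_deriv i g \<epsilon>)"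

lemma energy_fourier:
  "energy n f g
   = (\<Sum>A\<in>Pow {1..n}. real (card A) * (fourier_coeff n f A * fourier_coeff n g A))"
proof -
  have "energy n f g
      = (\<Sum>i\<in>{1..n}. \<Sum>A\<in>Pow {1..n}. if i \<in> A then fourier_coeff n f A * fourier_coeff n g A else 0)"
    unfolding energy_def cube_avg_sum parseval by (intro sum.cong refl)
        (auto simp: fourier_discrete_deriv)
  also have "\<dots> = (\<Sum>A\<in>Pow {1..n}. \<Sum>i\<in>{1..n}. if i \<in> A then fourier_coeff n f A
      * fourier_coeff n g A else 0)"
    by (rule sum.swap)
  also have "\<dots> = (\<Sum>A\<in>Pow {1..n}. real (card A) * (fourier_coeff n f A * fourier_coeff n g A))"
    by (intro sum.cong refl) (auto simp: sum.If_cases Int_absorb1)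
  finally show ?thesis .
qed

text \<open>The derivative in \<open>r\<close> of the mean of \<open>f * noise n r g\<close>, in Walsh coordinates.\<close>

definition noise_slope ::
  "nat \<Rightarrow> real \<Rightarrow> ((nat \<Rightarrow> real) \<Rightarrow> real) \<Rightarrow> ((nat \<Rightarrow> real) \<Rightarrow> real) \<Rightarrow> real" where
  "noise_slope n r f g =
    (\<Sum>A\<in>Pow {1..n}. real (card A) * r ^ (card A - 1) * (fourier_coeff n f A * fourier_coeff n g A))"

lemma noise_pairing_derivative:
  "((\<lambda>r. cube_avg n (\<lambda>\<epsilon>. f \<epsilon> * noise n r g \<epsilon>)) has_real_derivative
    noise_slope n r f g) (at r)"
  unfolding cube_avg_noise noise_slope_def by (auto intro!: derivative_eq_intros sum.cong)

lemma energy_noise: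
  "energy n f (noise n r g) = r * noise_slope n r f g"
  unfolding energy_fourier noise_slope_def sum_distrib_left
proof (intro sum.cong refl)
  fix A assume "A \<in> Pow {1..n}"
  then show "real (card A) * (fourier_coeff n f A * fourier_coeff n (noise n r g) A)
    = r * (real (card A) * r ^ (card A - 1) * (fourier_coeff n f A * fourier_coeff n g A))"
    by (cases "card A") (auto simp: fourier_noise)
qed

section \<open>Norms and correlated pairs\<close>

text \<open>The expectation over pairs \<open>(\<epsilon>, \<delta>)\<close> that are uniform in each entry and \<open>r\<close>-correlated.\<close>

definition pair_avg :: "nat \<Rightarrow> real \<Rightarrow> ((nat \<Rightarrow> real) \<Rightarrow> (nat \<Rightarrow> real) \<Rightarrow> real) \<Rightarrow> real" where
  "pair_avg n r H = (\<Sum>\<epsilon>\<in>hypercube n. \<Sum>\<delta>\<in>hypercube n. noise_kernel n r \<epsilon> \<delta> * H \<epsilon> \<delta>) / 2 ^ n"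

lemma pair_avg_as_noise: "pair_avg n r (\<lambda>\<epsilon> \<delta>. f \<epsilon> * g \<delta>) = cube_avg n (\<lambda>\<epsilon>. f \<epsilon> * noise n r g \<epsilon>)"
  by (simp add: pair_avg_def cube_avg_def noise_def sum_distrib_left mult_ac)

lemma pair_avg_swap:
  "pair_avg n r H = cube_avg n (\<lambda>\<delta>. \<Sum>\<epsilon>\<in>hypercube n. noise_kernel n r \<epsilon> \<delta> * H \<epsilon> \<delta>)"
  unfolding pair_avg_def cube_avg_def by (subst sum.swap) simp

lemma pair_avg_fst: "pair_avg n r (\<lambda>\<epsilon> \<delta>. h \<epsilon>) = cube_avg n h"
  by (simp add: pair_avg_def cube_avg_def sum_noise_kernel' flip: sum_distrib_right)

lemma pair_avg_snd: "pair_avg n r (\<lambda>\<epsilon> \<delta>. h \<delta>) = cube_avg n h"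
  by (simp add: pair_avg_swap cube_avg_def sum_noise_kernel flip: sum_distrib_right)

lemma pair_avg_sum:
  "pair_avg n r (\<lambda>\<epsilon> \<delta>. \<Sum>i\<in>I. H i \<epsilon> \<delta>) = (\<Sum>i\<in>I. pair_avg n r (H i))"
proof -
  have "(\<Sum>\<epsilon>\<in>hypercube n. \<Sum>\<delta>\<in>hypercube n. \<Sum>i\<in>I. noise_kernel n r \<epsilon> \<delta> * H i \<epsilon> \<delta>)
      = (\<Sum>\<epsilon>\<in>hypercube n. \<Sum>i\<in>I. \<Sum>\<delta>\<in>hypercube n. noise_kernel n r \<epsilon> \<delta> * H i \<epsilon> \<delta>)"
    by (intro sum.cong refl sum.swap)
  also have "\<dots> = (\<Sum>i\<in>I. \<Sum>\<epsilon>\<in>hypercube n. \<Sum>\<delta>\<in>hypercube n. noise_kernel n r \<epsilon> \<delta> * H i \<epsilon> \<delta>)"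
    by (rule sum.swap)
  finally show ?thesis by (simp add: pair_avg_def sum_distrib_left sum_divide_distrib)
qed

lemma pair_avg_Holder:
  assumes pq: "1 < p" "1 < q" "1 / p + 1 / q = 1" and r: "0 \<le> r" "r \<le> 1"
  shows "\<bar>pair_avg n r (\<lambda>\<epsilon> \<delta>. F \<epsilon> \<delta> * G \<epsilon> \<delta>)\<bar>
    \<le> pair_avg n r (\<lambda>\<epsilon> \<delta>. \<bar>F \<epsilon> \<delta>\<bar> powr p) powr (1 / p)
      * pair_avg n r (\<lambda>\<epsilon> \<delta>. \<bar>G \<epsilon> \<delta>\<bar> powr q) powr (1 / q)"
proof -
  define I where "I = hypercube n \<times> hypercube n"
  define w where "w = (\<lambda>(\<epsilon>, \<delta>). noise_kernel n r \<epsilon> \<delta> / 2 ^ n)"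
  have pair: "pair_avg n r H = (\<Sum>z\<in>I. w z * H (fst z) (snd z))" for H
    by (simp add: pair_avg_def I_def w_def sum.cartesian_product sum_divide_distrib case_prod_unfold)
  have w: "0 \<le> w z" if "z \<in> I" for z
    using that r by (auto simp: I_def w_def noise_kernel_nonneg)
  have "\<bar>pair_avg n r (\<lambda>\<epsilon> \<delta>. F \<epsilon> \<delta> * G \<epsilon> \<delta>)\<bar>
      \<le> (\<Sum>z\<in>I. w z * (\<bar>F (fst z) (snd z)\<bar> * \<bar>G (fst z) (snd z)\<bar>))"
    unfolding pair by (rule order_trans[OF sum_abs]) (auto intro!: sum_mono simp: abs_mult w)
  also have "\<dots> \<le> (\<Sum>z\<in>I. w z * \<bar>F (fst z) (snd z)\<bar> powr p) powr (1 / p)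
      * (\<Sum>z\<in>I. w z * \<bar>G (fst z) (snd z)\<bar> powr q) powr (1 / q)"
    by (intro weighted_Holder pq w) (auto simp: I_def)
  finally show ?thesis by (simp add: pair)
qed

lemma Lp_norm_real: "Lp_norm n p (f :: _ \<Rightarrow> real) = cube_avg n (\<lambda>\<epsilon>. \<bar>f \<epsilon>\<bar> powr p) powr (1 / p)"
  by (simp add: Lp_norm_def cube_avg_def)

lemma Lp_norm_powr:
  "p > 0 \<Longrightarrow> Lp_norm n p (f :: _ \<Rightarrow> real) powr p = cube_avg n (\<lambda>\<epsilon>. \<bar>f \<epsilon>\<bar> powr p)"
  by (simp add: Lp_norm_real powr_powr cube_avg_nonneg)

lemma Lp_norm_nonneg [simp]: "0 \<le> Lp_norm n p f"
  by (simp add: Lp_norm_def)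

text \<open>The contraction property of the noise operator in its bilinear form: Hoelder on the space of
  correlated pairs, whose two marginals are uniform.\<close>

lemma noise_Holder:
  assumes "1 < p" "1 < q" "1 / p + 1 / q = 1" and "0 \<le> r" "r \<le> 1"
  shows "\<bar>cube_avg n (\<lambda>\<epsilon>. f \<epsilon> * noise n r g \<epsilon>)\<bar> \<le> Lp_norm n p f * Lp_norm n q g"
  using pair_avg_Holder[OF assms, of n "\<lambda>\<epsilon> \<delta>. f \<epsilon>" "\<lambda>\<epsilon> \<delta>. g \<delta>"]
  by (simp add: pair_avg_as_noise pair_avg_fst pair_avg_snd Lp_norm_real)

lemma cube_Holder:
  assumes "1 < p" "1 < q" "1 / p + 1 / q = 1"
  shows "\<bar>cube_avg n (\<lambda>\<epsilon>. f \<epsilon> * g \<epsilon>)\<bar> \<le> Lp_norm n p f * Lp_norm n q g"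
proof -
  have "cube_avg n (\<lambda>\<epsilon>. f \<epsilon> * noise n 1 g \<epsilon>) = cube_avg n (\<lambda>\<epsilon>. f \<epsilon> * g \<epsilon>)"
    by (intro cube_avg_cong) (simp add: noise_one)
  then show ?thesis using noise_Holder[OF assms, of 1 n f g] by simp
qed

definition grad_length :: "nat \<Rightarrow> ((nat \<Rightarrow> real) \<Rightarrow> real) \<Rightarrow> (nat \<Rightarrow> real) \<Rightarrow> real" where
  "grad_length n f \<epsilon> = sqrt (\<Sum>i\<in>{1..n}. (discrete_deriv i f \<epsilon>)\<^sup>2)"

lemma grad_length_nonneg [simp]: "0 \<le> grad_length n f \<epsilon>"
  by (simp add: grad_length_def sum_nonneg)

lemma grad_length_sq: "(grad_length n f \<epsilon>)\<^sup>2 = (\<Sum>i\<in>{1..n}. (discrete_deriv i f \<epsilon>)\<^sup>2)"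
  by (simp add: grad_length_def sum_nonneg)

section \<open>Removing noise for exponents at most two\<close>

text \<open>Multiplication by the coordinate \<open>i\<close> permutes the Walsh functions in this way.\<close>

definition toggle :: "nat \<Rightarrow> nat set \<Rightarrow> nat set" where
  "toggle i A = (if i \<in> A then A - {i} else insert i A)"

lemma toggle_toggle: "toggle i (toggle i A) = A"
  by (auto simp: toggle_def)

lemma fourier_coeff_toggle:
  assumes "i \<in> {1..n}" "A \<subseteq> {1..n}"
  shows "fourier_coeff n (\<lambda>\<epsilon>. \<epsilon> i * f \<epsilon>) (toggle i A) = fourier_coeff n f A"
  unfolding fourier_coeff_def
proof (intro cube_avg_cong)
  fix \<epsilon> assume e: "\<epsilon> \<in> hypercube n"
  have fin: "finite A" using assms(2) finite_subset by blast
  have "\<epsilon> i * walsh (toggle i A) \<epsilon> = walsh A \<epsilon>"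
  proof (cases "i \<in> A")
    case True
    then show ?thesis using fin by (simp add: toggle_def walsh_def prod.remove[of A i])
  next
    case False
    then show ?thesis using fin hypercube_coord_sq[OF e assms(1)]
      by (simp add: toggle_def walsh_def flip: mult.assoc)
  qed
  then show "\<epsilon> i * f \<epsilon> * walsh (toggle i A) \<epsilon> = f \<epsilon> * walsh A \<epsilon>"
    by (metis mult.assoc mult.commute)
qed

text \<open>The \<open>i\<close>-th summand of \<open>noise_derivative_as_pairing\<close>. The product \<open>\<epsilon> i * \<delta> i\<close> lowers the
  power of \<open>r\<close> by one on the Walsh functions that contain \<open>i\<close>, and the derivative leaves no
  others.\<close>

lemma correlated_coordinate_pairing:
  assumes i: "i \<in> {1..n}"
  shows "pair_avg n r (\<lambda>\<epsilon> \<delta>. g \<epsilon> * ((\<epsilon> i * \<delta> i - r) * discrete_deriv i f \<delta>))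
    = (1 - r\<^sup>2) * (\<Sum>A\<in>Pow {1..n}. if i \<in> A then r ^ (card A - 1) * (fourier_coeff n f A
        * fourier_coeff n g A) else 0)"
proof -
  let ?h = "discrete_deriv i f"
  have "pair_avg n r (\<lambda>\<epsilon> \<delta>. g \<epsilon> * ((\<epsilon> i * \<delta> i - r) * ?h \<delta>))
     = pair_avg n r (\<lambda>\<epsilon> \<delta>. (\<epsilon> i * g \<epsilon>) * (\<delta> i * ?h \<delta>)) - r * pair_avg n r (\<lambda>\<epsilon> \<delta>. g \<epsilon> * ?h \<delta>)"
    unfolding pair_avg_def
    by (simp add: algebra_simps sum_subtractf sum_distrib_left diff_divide_distrib)
  also have "pair_avg n r (\<lambda>\<epsilon> \<delta>. (\<epsilon> i * g \<epsilon>) * (\<delta> i * ?h \<delta>))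
     = (\<Sum>A\<in>Pow {1..n}. r ^ card A * (fourier_coeff n (\<lambda>\<epsilon>. \<epsilon> i * g \<epsilon>) A * fourier_coeff n (\<lambda>\<delta>. \<delta> i
         * ?h \<delta>) A))"
    by (simp only: pair_avg_as_noise cube_avg_noise)
  \<comment> \<open>toggling \<open>i\<close> undoes the multiplication by the coordinate; only sets containing \<open>i\<close> survive,
      as \<open>?h\<close> has no others\<close>
  also have "\<dots> = (\<Sum>A\<in>Pow {1..n}. r ^ card (toggle i A) *
      (fourier_coeff n (\<lambda>\<epsilon>. \<epsilon> i * g \<epsilon>) (toggle i A) * fourier_coeff n (\<lambda>\<delta>. \<delta> i * ?h \<delta>) (toggle i A)))"
    by (rule sum.reindex_bij_witness[of _ "toggle i" "toggle i"])
       (use i in \<open>auto simp: toggle_toggle\<close>, auto simp: toggle_def split: if_splits)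
  also have "\<dots> = (\<Sum>A\<in>Pow {1..n}. if i \<in> A then r ^ (card A - 1) * (fourier_coeff n f A
      * fourier_coeff n g A) else 0)"
  proof (intro sum.cong refl)
    fix A assume A: "A \<in> Pow {1..n}"
    then have "finite A" using finite_subset by auto
    then show "r ^ card (toggle i A) * (fourier_coeff n (\<lambda>\<epsilon>. \<epsilon> i * g \<epsilon>) (toggle i A) *
        fourier_coeff n (\<lambda>\<delta>. \<delta> i * ?h \<delta>) (toggle i A))
      = (if i \<in> A then r ^ (card A - 1) * (fourier_coeff n f A * fourier_coeff n g A) else 0)"
      using A i unfolding fourier_coeff_toggle[OF i A[unfolded Pow_iff]]
      by (auto simp: fourier_discrete_deriv toggle_def)
  qed
  also have "r * pair_avg n r (\<lambda>\<epsilon> \<delta>. g \<epsilon> * ?h \<delta>)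
     = r\<^sup>2 * (\<Sum>A\<in>Pow {1..n}. if i \<in> A then r ^ (card A - 1) * (fourier_coeff n f A
         * fourier_coeff n g A) else 0)"
    unfolding pair_avg_as_noise cube_avg_noise sum_distrib_left
  proof (intro sum.cong refl)
    fix A assume A: "A \<in> Pow {1..n}"
    show "r * (r ^ card A * (fourier_coeff n g A * fourier_coeff n ?h A)) = r\<^sup>2 *
      (if i \<in> A then r ^ (card A - 1) * (fourier_coeff n f A * fourier_coeff n g A) else 0)"
    proof (cases "i \<in> A")
      case True
      then have "card A > 0" using A by (auto simp: card_gt_0_iff intro: finite_subset)
      then have "r ^ card A = r * r ^ (card A - 1)" by (simp add: power_eq_if)
      then show ?thesis using A i True by (simp add: fourier_discrete_deriv power2_eq_square)
    next
      case False
      then show ?thesis using A i by (simp add: fourier_discrete_deriv)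
    qed
  qed
  finally show ?thesis by (simp add: algebra_simps)
qed

text \<open>Integration by parts in the noise kernel. The derivative of the noise operator is again an
  average over correlated pairs, now involving only first derivatives of \<open>f\<close>. This is the source
  of the gradient in the case \<open>p \<le> 2\<close>.\<close>

lemma noise_derivative_as_pairing:
  "pair_avg n r (\<lambda>\<epsilon> \<delta>. g \<epsilon> * (\<Sum>i\<in>{1..n}. (\<epsilon> i * \<delta> i - r) * discrete_deriv i f \<delta>))
    = (1 - r\<^sup>2) * noise_slope n r f g"
proof -
  have "pair_avg n r (\<lambda>\<epsilon> \<delta>. g \<epsilon> * (\<Sum>i\<in>{1..n}. (\<epsilon> i * \<delta> i - r) * discrete_deriv i f \<delta>))
    = (\<Sum>i\<in>{1..n}. pair_avg n r (\<lambda>\<epsilon> \<delta>. g \<epsilon> * ((\<epsilon> i * \<delta> i - r) * discrete_deriv i f \<delta>)))"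
    unfolding sum_distrib_left pair_avg_sum ..
  also have "\<dots> = (1 - r\<^sup>2) * (\<Sum>i\<in>{1..n}. \<Sum>A\<in>Pow {1..n}. if i \<in> A then r ^ (card A - 1)
      * (fourier_coeff n f A * fourier_coeff n g A) else 0)"
    by (simp only: correlated_coordinate_pairing sum_distrib_left cong: sum.cong)
  also have "\<dots> = (1 - r\<^sup>2) * (\<Sum>A\<in>Pow {1..n}. \<Sum>i\<in>{1..n}. if i \<in> A then r ^ (card A - 1)
      * (fourier_coeff n f A * fourier_coeff n g A) else 0)"
    by (subst sum.swap) simp
  also have "\<dots> = (1 - r\<^sup>2) * noise_slope n r f g"
    unfolding noise_slope_def
    by (intro arg_cong[of _ _ "\<lambda>x. (1 - r\<^sup>2) * x"] sum.cong refl) (auto simp: sum.If_cases Int_absorb1)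
  finally show ?thesis .
qed

lemma correlated_covariance:
  assumes d: "\<delta> \<in> hypercube n" and ij: "i \<in> {1..n}" "j \<in> {1..n}"
  shows "(\<Sum>\<epsilon>\<in>hypercube n. noise_kernel n r \<epsilon> \<delta> * ((\<epsilon> i * \<delta> i - r) * (\<epsilon> j * \<delta> j - r)))
    = (if i = j then 1 - r\<^sup>2 else 0)"
proof -
  let ?E = "\<lambda>h. \<Sum>\<epsilon>\<in>hypercube n. noise_kernel n r \<epsilon> \<delta> * h \<epsilon>"
  have E0: "?E (\<lambda>_. 1) = 1" using sum_noise_kernel[OF d] by simp
  have E1: "?E (\<lambda>\<epsilon>. \<epsilon> k) = r * \<delta> k" if "k \<in> {1..n}" for k
    using noise_kernel_walsh[of "{k}" n \<delta> r] that d by (simp add: walsh_def)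
  have E2: "?E (\<lambda>\<epsilon>. \<epsilon> i * \<epsilon> j) = (if i = j then 1 else r\<^sup>2 * (\<delta> i * \<delta> j))"
  proof (cases "i = j")
    case True
    have "?E (\<lambda>\<epsilon>. \<epsilon> i * \<epsilon> j) = ?E (\<lambda>_. 1)"
      using True ij by (intro sum.cong refl) (simp add: hypercube_coord_sq)
    then show ?thesis using True E0 by simp
  next
    case False
    then show ?thesis using noise_kernel_walsh[of "{i, j}" n \<delta> r] ij d by
        (simp add: walsh_def power2_eq_square)
  qed
  have "?E (\<lambda>\<epsilon>. (\<epsilon> i * \<delta> i - r) * (\<epsilon> j * \<delta> j - r))
    = \<delta> i * \<delta> j * ?E (\<lambda>\<epsilon>. \<epsilon> i * \<epsilon> j) - r * \<delta> i * ?E (\<lambda>\<epsilon>. \<epsilon> i) - r * \<delta> j * ?E (\<lambda>\<epsilon>. \<epsilon> j) + r\<^sup>2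
        * ?E (\<lambda>_. 1)"
    unfolding sum_distrib_left sum_subtractf[symmetric] sum.distrib[symmetric]
    by (intro sum.cong refl) (simp add: algebra_simps power2_eq_square)
  also have "\<dots> = \<delta> i * \<delta> j * (if i = j then 1 else r\<^sup>2 * (\<delta> i * \<delta> j)) - r\<^sup>2 * (\<delta> i * \<delta> i) - r\<^sup>2
      * (\<delta> j * \<delta> j) + r\<^sup>2"
    unfolding E0 E1[OF ij(1)] E1[OF ij(2)] E2 by (simp add: power2_eq_square)
  also have "\<dots> = (if i = j then 1 - r\<^sup>2 else 0)"
    using hypercube_coord_sq[OF d ij(1)] hypercube_coord_sq[OF d ij(2)]
    by (auto simp: algebra_simps)
  finally show ?thesis .
qed

text \<open>The conditional variance of the random sum in \<open>noise_derivative_as_pairing\<close>; orthogonality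
  of its terms is where the Euclidean length of the gradient comes from.\<close>

lemma correlated_second_moment:
  assumes d: "\<delta> \<in> hypercube n"
  shows "(\<Sum>\<epsilon>\<in>hypercube n. noise_kernel n r \<epsilon> \<delta> * (\<Sum>i\<in>{1..n}. (\<epsilon> i * \<delta> i - r) * a i)\<^sup>2)
    = (1 - r\<^sup>2) * (\<Sum>i\<in>{1..n}. (a i)\<^sup>2)"
proof -
  have "(\<Sum>\<epsilon>\<in>hypercube n. noise_kernel n r \<epsilon> \<delta> * (\<Sum>i\<in>{1..n}. (\<epsilon> i * \<delta> i - r) * a i)\<^sup>2)
    = (\<Sum>\<epsilon>\<in>hypercube n. \<Sum>i\<in>{1..n}. \<Sum>j\<in>{1..n}. a i * a j * (noise_kernel n r \<epsilon> \<delta> * ((\<epsilon> i * \<delta> i - r)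
        * (\<epsilon> j * \<delta> j - r))))"
    by (intro sum.cong refl) (simp add: power2_eq_square sum_product sum_distrib_left mult_ac)
  also have "\<dots> = (\<Sum>i\<in>{1..n}. \<Sum>j\<in>{1..n}. a i * a j * (\<Sum>\<epsilon>\<in>hypercube n. noise_kernel n r \<epsilon> \<delta> * ((\<epsilon> i
      * \<delta> i - r) * (\<epsilon> j * \<delta> j - r))))"
    unfolding sum_distrib_left by (subst sum.swap, intro sum.cong refl, subst sum.swap) (rule refl)
  also have "\<dots> = (\<Sum>i\<in>{1..n}. \<Sum>j\<in>{1..n}. a i * a j * (if i = j then 1 - r\<^sup>2 else 0))"
    using d by (intro sum.cong refl arg_cong2[of _ _ _ _ "(*)"] correlated_covariance)
  also have "\<dots> = (1 - r\<^sup>2) * (\<Sum>i\<in>{1..n}. (a i)\<^sup>2)"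
    by (simp add: if_distrib[of "\<lambda>x. _ * x"] sum.delta sum_distrib_left power2_eq_square mult_ac
        cong: if_cong)
  finally show ?thesis .
qed

text \<open>The restriction \<open>p \<le> 2\<close> enters here and only here: the conditional \<open>p\<close>-th moment is bounded
  by the second moment. For \<open>p > 2\<close> the \<open>p\<close>-th moments of \<open>\<epsilon> i * \<delta> i - r\<close> are of order \<open>1 - r\<close> as
  \<open>r\<close> tends to 1, much larger than the power \<open>p / 2\<close> of the variance.\<close>

lemma Lp_norm_correlated_sum:
  assumes p: "1 < p" "p \<le> 2" and r: "0 \<le> r" "r \<le> 1"
  shows "pair_avg n r (\<lambda>\<epsilon> \<delta>. \<bar>\<Sum>i\<in>{1..n}. (\<epsilon> i * \<delta> i - r) * discrete_deriv i f \<delta>\<bar> powr p) powr (1 / p)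
    \<le> sqrt (1 - r\<^sup>2) * Lp_norm n p (grad_length n f)"
proof -
  let ?S = "\<lambda>\<epsilon> \<delta>. \<Sum>i\<in>{1..n}. (\<epsilon> i * \<delta> i - r) * discrete_deriv i f \<delta>"
  define v where "v = sqrt (1 - r\<^sup>2)"
  have r2: "0 \<le> 1 - r\<^sup>2" using r by (simp add: power_le_one)
  have v0: "0 \<le> v" unfolding v_def using r2 by simp
  have fibre: "(\<Sum>\<epsilon>\<in>hypercube n. noise_kernel n r \<epsilon> \<delta> * \<bar>?S \<epsilon> \<delta>\<bar> powr p)
      \<le> v powr p * \<bar>grad_length n f \<delta>\<bar> powr p" if d: "\<delta> \<in> hypercube n" for \<delta>
  proof -
    have "(\<Sum>\<epsilon>\<in>hypercube n. noise_kernel n r \<epsilon> \<delta> * \<bar>?S \<epsilon> \<delta>\<bar> powr p)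
      \<le> (\<Sum>\<epsilon>\<in>hypercube n. noise_kernel n r \<epsilon> \<delta> * \<bar>?S \<epsilon> \<delta>\<bar> powr 2) powr (p / 2)"
      using p r d by (intro weighted_power_mean) (auto simp: noise_kernel_nonneg sum_noise_kernel)
    also have "(\<Sum>\<epsilon>\<in>hypercube n. noise_kernel n r \<epsilon> \<delta> * \<bar>?S \<epsilon> \<delta>\<bar> powr 2)
      = (1 - r\<^sup>2) * (grad_length n f \<delta>)\<^sup>2"
      using correlated_second_moment[OF d, of r "\<lambda>i. discrete_deriv i f \<delta>"]
      by (simp add: grad_length_sq)
    also have "\<dots> = (v * grad_length n f \<delta>) powr 2"
      using r2 v0 by (simp add: v_def power_mult_distrib)
    also have "\<dots> powr (p / 2) = v powr p * \<bar>grad_length n f \<delta>\<bar> powr p"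
      using v0 by (simp add: powr_powr powr_mult del: powr_numeral)
    finally show ?thesis .
  qed
  have "pair_avg n r (\<lambda>\<epsilon> \<delta>. \<bar>?S \<epsilon> \<delta>\<bar> powr p)
      \<le> cube_avg n (\<lambda>\<delta>. v powr p * \<bar>grad_length n f \<delta>\<bar> powr p)"
    unfolding pair_avg_swap by (rule cube_avg_mono) (rule fibre)
  also have "\<dots> = v powr p * Lp_norm n p (grad_length n f) powr p"
    using p by (simp add: cube_avg_cmult Lp_norm_powr)
  finally have "pair_avg n r (\<lambda>\<epsilon> \<delta>. \<bar>?S \<epsilon> \<delta>\<bar> powr p)
      \<le> v powr p * Lp_norm n p (grad_length n f) powr p" .
  moreover have "0 \<le> pair_avg n r (\<lambda>\<epsilon> \<delta>. \<bar>?S \<epsilon> \<delta>\<bar> powr p)"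
    unfolding pair_avg_swap using r by (auto intro!: cube_avg_nonneg sum_nonneg simp:
        noise_kernel_nonneg)
  ultimately have "pair_avg n r (\<lambda>\<epsilon> \<delta>. \<bar>?S \<epsilon> \<delta>\<bar> powr p) powr (1 / p)
      \<le> (v powr p * Lp_norm n p (grad_length n f) powr p) powr (1 / p)"
    using p by (intro powr_mono2) auto
  also have "\<dots> = v * Lp_norm n p (grad_length n f)"
    using v0 p by (simp add: powr_mult powr_powr)
  finally show ?thesis by (simp add: v_def)
qed

lemma noise_increment_le2:
  assumes p: "1 < p" "p \<le> 2" and q: "1 / p + 1 / q = 1" and s: "0 \<le> s" "s \<le> 1"
  shows "cube_avg n (\<lambda>\<epsilon>. f \<epsilon> * noise n 1 g \<epsilon>) - cube_avg n (\<lambda>\<epsilon>. f \<epsilon> * noise n s g \<epsilon>)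
    \<le> 2 * sqrt (1 - s) * Lp_norm n p (grad_length n f) * Lp_norm n q g"
proof -
  define C where "C = Lp_norm n p (grad_length n f) * Lp_norm n q g"
  have C0: "C \<ge> 0" by (simp add: C_def)
  have q1: "1 < q" using conjugate_exponent_gt_one p q by blast
  define \<psi> where "\<psi> = (\<lambda>r. cube_avg n (\<lambda>\<epsilon>. f \<epsilon> * noise n r g \<epsilon>))"
  define D where "D = (\<lambda>r. noise_slope n r f g)"
  have deriv: "(\<psi> has_real_derivative D r) (at r)" for r
    unfolding \<psi>_def D_def by (rule noise_pairing_derivative)
  \<comment> \<open>the random sum has norm of order \<open>sqrt (1 - r\<^sup>2)\<close>, so dividing by \<open>1 - r\<^sup>2\<close> leaves an
      integrable singularity at 1\<close>
  have D_le: "D r \<le> C / sqrt (1 - r)" if r: "0 \<le> r" "r < 1" for r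
  proof -
    have r2: "0 < 1 - r\<^sup>2" using r by (simp add: power_less_one_iff abs_square_less_1)
    have "(1 - r\<^sup>2) * D r = pair_avg n r (\<lambda>\<epsilon> \<delta>. g \<epsilon> * (\<Sum>i\<in>{1..n}. (\<epsilon> i * \<delta> i - r)
        * discrete_deriv i f \<delta>))"
      unfolding D_def by (rule noise_derivative_as_pairing[symmetric])
    also have "\<dots> \<le> pair_avg n r (\<lambda>\<epsilon> \<delta>. \<bar>g \<epsilon>\<bar> powr q) powr (1 / q) *
       pair_avg n r (\<lambda>\<epsilon> \<delta>. \<bar>\<Sum>i\<in>{1..n}. (\<epsilon> i * \<delta> i - r) * discrete_deriv i f \<delta>\<bar> powr p) powr (1 / p)"
      by (rule order_trans[OF abs_ge_self pair_avg_Holder]) (use p q q1 r in auto)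
    also have "\<dots> \<le> Lp_norm n q g * (sqrt (1 - r\<^sup>2) * Lp_norm n p (grad_length n f))"
      using p r by (intro mult_mono Lp_norm_correlated_sum) (auto simp: pair_avg_fst Lp_norm_real)
    also have "\<dots> = (1 - r\<^sup>2) * (C / sqrt (1 - r\<^sup>2))"
      using r2 by (simp add: C_def field_simps)
    finally have "D r \<le> C / sqrt (1 - r\<^sup>2)" by (rule mult_left_le_imp_le[OF _ r2])
    also have "\<dots> \<le> C / sqrt (1 - r)"
    proof (intro divide_left_mono C0 real_sqrt_le_mono)
      show "1 - r \<le> 1 - r\<^sup>2" using r by (simp add: power2_eq_square mult_left_le)
    qed (use r r2 in auto)
    finally show ?thesis .
  qed
  \<comment> \<open>\<open>- 2 * C * sqrt (1 - r)\<close> is a primitive of the bound \<open>C / sqrt (1 - r)\<close>\<close>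
  have "- 2 * C * sqrt (1 - s) - \<psi> s \<le> - 2 * C * sqrt (1 - 1) - \<psi> 1"
  proof (rule DERIV_nonneg_imp_increasing_open[OF s(2)])
    fix r assume r: "s < r" "r < 1"
    have "((\<lambda>r. - 2 * C * sqrt (1 - r) - \<psi> r) has_real_derivative (C / sqrt (1 - r) - D r)) (at r)"
      using r by (auto intro!: derivative_eq_intros deriv simp: field_simps)
    moreover have "0 \<le> C / sqrt (1 - r) - D r" using D_le r s by simp
    ultimately show "\<exists>y. ((\<lambda>r. - 2 * C * sqrt (1 - r) - \<psi> r) has_real_derivative y) (at r) \<and> 0 \<le> y"
      by blast
  next
    have "continuous_on {s..1} \<psi>"
      by (meson DERIV_isCont deriv continuous_at_imp_continuous_on)
    then show "continuous_on {s..1} (\<lambda>r. - 2 * C * sqrt (1 - r) - \<psi> r)"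
      by (intro continuous_intros)
  qed
  then show ?thesis by (simp add: \<psi>_def C_def algebra_simps)
qed

section \<open>Energy inequalities for positive functions\<close>

text \<open>An edge function, one that agrees at both ends of each edge in direction \<open>i\<close>, may be
  averaged by looking only at the end where \<open>u\<close> is larger.\<close>

lemma cube_avg_flip_symmetric:
  fixes u :: "(nat \<Rightarrow> real) \<Rightarrow> real"
  assumes i: "i \<in> {1..n}" and sym: "\<And>\<epsilon>. F (flip i \<epsilon>) = F \<epsilon>"
    and zero: "\<And>\<epsilon>. u (flip i \<epsilon>) = u \<epsilon> \<Longrightarrow> F \<epsilon> = 0"
  shows "cube_avg n F = 2 * cube_avg n (\<lambda>\<epsilon>. if u (flip i \<epsilon>) < u \<epsilon> then F \<epsilon> else 0)"
proof -
  let ?up = "\<lambda>\<epsilon>. if u (flip i \<epsilon>) < u \<epsilon> then F \<epsilon> else (0::real)"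
  have "cube_avg n F = cube_avg n (\<lambda>\<epsilon>. ?up \<epsilon> + ?up (flip i \<epsilon>))"
  proof (intro cube_avg_cong)
    fix \<epsilon>
    show "F \<epsilon> = ?up \<epsilon> + ?up (flip i \<epsilon>)"
      using zero[of \<epsilon>] by (cases "u (flip i \<epsilon>)" "u \<epsilon>" rule: linorder_cases) (auto simp: sym)
  qed
  also have "\<dots> = cube_avg n ?up + cube_avg n (\<lambda>\<epsilon>. ?up (flip i \<epsilon>))"
    by (rule cube_avg_add)
  also have "cube_avg n (\<lambda>\<epsilon>. ?up (flip i \<epsilon>)) = cube_avg n ?up"
    by (rule cube_avg_flip[OF i])
  finally show ?thesis by simp
qed

text \<open>The squared gradient restricted to the edges along which \<open>u\<close> decreases. The full gradient
  would not do for \<open>q < 2\<close>: at a point where \<open>u\<close> is much smaller than at its neighbours,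
  \<open>u powr (q - 2)\<close> times the full squared gradient is out of control.\<close>

definition up_grad_sq :: "nat \<Rightarrow> ((nat \<Rightarrow> real) \<Rightarrow> real) \<Rightarrow> (nat \<Rightarrow> real) \<Rightarrow> real" where
  "up_grad_sq n u \<epsilon> = (\<Sum>i\<in>{1..n}. if u (flip i \<epsilon>) < u \<epsilon> then (discrete_deriv i u \<epsilon>)\<^sup>2 else 0)"

lemma energy_upward:
  "energy n f u = 2 * cube_avg n (\<lambda>\<epsilon>. \<Sum>i\<in>{1..n}. if u (flip i \<epsilon>) < u \<epsilon> then discrete_deriv i f \<epsilon>
      * discrete_deriv i u \<epsilon> else 0)"
proof -
  have "energy n f u = (\<Sum>i\<in>{1..n}. 2 * cube_avg n (\<lambda>\<epsilon>. if u (flip i \<epsilon>) < u \<epsilon>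
      then discrete_deriv i f \<epsilon> * discrete_deriv i u \<epsilon> else 0))"
    unfolding energy_def cube_avg_sum
    by (intro sum.cong refl cube_avg_flip_symmetric)
       (auto simp: discrete_deriv_flip, auto simp: discrete_deriv_def)
  then show ?thesis by (simp add: cube_avg_sum sum_distrib_left)
qed

text \<open>On an edge seen from its larger end, \<open>powr_diff_ge_tangent\<close> turns the weight
  \<open>u powr (q - 2)\<close> into a difference of \<open>u powr (q - 1)\<close>. The factor 2 compensates for seeing each
  edge from one end.\<close>

lemma up_grad_energy:
  assumes q: "1 < q" "q \<le> 2" and pos: "\<And>\<epsilon>. \<epsilon> \<in> hypercube n \<Longrightarrow> 0 < u \<epsilon>"
  shows "2 * (q - 1) * cube_avg n (\<lambda>\<epsilon>. u \<epsilon> powr (q - 2) * up_grad_sq n u \<epsilon>)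
      \<le> energy n (\<lambda>\<epsilon>. u \<epsilon> powr (q - 1)) u"
proof -
  have "(q - 1) * (u \<epsilon> powr (q - 2) * up_grad_sq n u \<epsilon>) \<le> (\<Sum>i\<in>{1..n}. if u (flip i \<epsilon>) < u \<epsilon>
      then discrete_deriv i (\<lambda>\<epsilon>. u \<epsilon> powr (q - 1)) \<epsilon> * discrete_deriv i u \<epsilon> else 0)"
    if e: "\<epsilon> \<in> hypercube n" for \<epsilon>
    unfolding up_grad_sq_def sum_distrib_left
  proof (intro sum_mono)
    fix i assume i: "i \<in> {1..n}"
    have pos': "0 < u \<epsilon>" "0 < u (flip i \<epsilon>)" using pos e i flip_in_hypercube by blast+
    show "(q - 1) * (u \<epsilon> powr (q - 2) * (if u (flip i \<epsilon>) < u \<epsilon> then (discrete_deriv i u \<epsilon>)\<^sup>2 else 0))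
      \<le> (if u (flip i \<epsilon>) < u \<epsilon> then discrete_deriv i (\<lambda>\<epsilon>. u \<epsilon> powr (q - 1)) \<epsilon>
          * discrete_deriv i u \<epsilon> else 0)"
    proof (cases "u (flip i \<epsilon>) < u \<epsilon>")
      case True
      have "(q - 1) * (u \<epsilon> powr (q - 2) * (u \<epsilon> - u (flip i \<epsilon>))) * (u \<epsilon> - u (flip i \<epsilon>))
        \<le> (u \<epsilon> powr (q - 1) - u (flip i \<epsilon>) powr (q - 1)) * (u \<epsilon> - u (flip i \<epsilon>))"
        using True pos' q by (intro mult_right_mono powr_diff_ge_tangent) auto
      then show ?thesis using True
        by (simp add: discrete_deriv_def power2_eq_square mult_ac divide_right_mono)
    qed simp
  qed
  then have "cube_avg n (\<lambda>\<epsilon>. (q - 1) * (u \<epsilon> powr (q - 2) * up_grad_sq n u \<epsilon>)) \<le>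
    cube_avg n (\<lambda>\<epsilon>. \<Sum>i\<in>{1..n}. if u (flip i \<epsilon>) < u \<epsilon> then discrete_deriv i (\<lambda>\<epsilon>. u \<epsilon> powr (q - 1)) \<epsilon>
        * discrete_deriv i u \<epsilon> else 0)"
    by (rule cube_avg_mono)
  then show ?thesis unfolding energy_upward cube_avg_cmult by (simp only: mult.assoc)
qed

lemma energy_powr_nonneg:
  assumes q: "1 < q" "q \<le> 2" and pos: "\<And>\<epsilon>. \<epsilon> \<in> hypercube n \<Longrightarrow> 0 < u \<epsilon>"
  shows "0 \<le> energy n (\<lambda>\<epsilon>. u \<epsilon> powr (q - 1)) u"
proof -
  have "0 \<le> cube_avg n (\<lambda>\<epsilon>. u \<epsilon> powr (q - 2) * up_grad_sq n u \<epsilon>)"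
    by (intro cube_avg_nonneg mult_nonneg_nonneg) (auto simp: up_grad_sq_def intro: sum_nonneg)
  then have "0 \<le> 2 * (q - 1) * cube_avg n (\<lambda>\<epsilon>. u \<epsilon> powr (q - 2) * up_grad_sq n u \<epsilon>)"
    using q by simp
  also have "\<dots> \<le> energy n (\<lambda>\<epsilon>. u \<epsilon> powr (q - 1)) u"
    by (rule up_grad_energy[OF q pos])
  finally show ?thesis .
qed

text \<open>The spectral gap: every nonempty \<open>A\<close> has at least one element.\<close>

lemma cube_poincare:
  "cube_avg n (\<lambda>\<epsilon>. (F \<epsilon>)\<^sup>2) - (cube_avg n F)\<^sup>2 \<le> energy n F F"
proof -
  have "cube_avg n (\<lambda>\<epsilon>. (F \<epsilon>)\<^sup>2) = (\<Sum>A\<in>Pow {1..n}. (fourier_coeff n F A)\<^sup>2)"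
    by (simp add: power2_eq_square parseval)
  also have "\<dots> = (fourier_coeff n F {})\<^sup>2 + (\<Sum>A\<in>Pow {1..n} - {{}}. (fourier_coeff n F A)\<^sup>2)"
    by (subst sum.remove[of _ "{}"]) auto
  also have "(\<Sum>A\<in>Pow {1..n} - {{}}. (fourier_coeff n F A)\<^sup>2)
      \<le> (\<Sum>A\<in>Pow {1..n} - {{}}. real (card A) * (fourier_coeff n F A * fourier_coeff n F A))"
  proof (intro sum_mono)
    fix A assume "A \<in> Pow {1..n} - {{}}"
    then have "1 \<le> card A" using finite_subset[of A "{1..n}"] by (simp add: Suc_le_eq card_gt_0_iff)
    then have "1 * (fourier_coeff n F A)\<^sup>2 \<le> real (card A) * (fourier_coeff n F A)\<^sup>2"
      by (intro mult_right_mono) auto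
    then show "(fourier_coeff n F A)\<^sup>2 \<le> real (card A) * (fourier_coeff n F A * fourier_coeff n F A)"
      by (simp add: power2_eq_square)
  qed
  also have "\<dots> \<le> energy n F F"
    unfolding energy_fourier by (intro sum_mono2) auto
  also have "fourier_coeff n F {} = cube_avg n F" by (simp add: fourier_coeff_def walsh_def)
  finally show ?thesis by simp
qed

text \<open>The Poincare inequality for \<open>u powr (q / 2)\<close>, whose squared mean is at most the \<open>q\<close>-th power
  of the mean of \<open>u\<close> because \<open>q / 2 \<le> 1\<close>.\<close>

lemma cube_beckner:
  assumes q: "1 < q" "q \<le> 2" and pos: "\<And>\<epsilon>. \<epsilon> \<in> hypercube n \<Longrightarrow> 0 < u \<epsilon>"
  shows "(q - 1) * (cube_avg n (\<lambda>\<epsilon>. u \<epsilon> powr q) - cube_avg n u powr q)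
      \<le> energy n (\<lambda>\<epsilon>. u \<epsilon> powr (q - 1)) u"
proof -
  let ?F = "\<lambda>\<epsilon>. u \<epsilon> powr (q / 2)"
  have "cube_avg n (\<lambda>\<epsilon>. u \<epsilon> powr q) = cube_avg n (\<lambda>\<epsilon>. (?F \<epsilon>)\<^sup>2)"
    by (simp add: power2_eq_square flip: powr_add)
  moreover have "(cube_avg n ?F)\<^sup>2 \<le> cube_avg n u powr q"
  proof -
    have "(\<Sum>\<epsilon>\<in>hypercube n. 1 / 2 ^ n * u \<epsilon> powr (q / 2)) \<le> (\<Sum>\<epsilon>\<in>hypercube n. 1 / 2 ^ n
        * u \<epsilon> powr 1) powr (q / 2 / 1)"
      using pos q by (intro weighted_power_mean) (auto simp: less_imp_le card_hypercube)
    also have "(\<Sum>\<epsilon>\<in>hypercube n. 1 / 2 ^ n * u \<epsilon> powr 1) = cube_avg n u"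
      using pos unfolding cube_avg_def sum_divide_distrib by (intro sum.cong) (auto simp: less_imp_le)
    finally have "cube_avg n ?F \<le> cube_avg n u powr (q / 2)"
      by (simp add: cube_avg_def sum_divide_distrib)
    then have "(cube_avg n ?F)\<^sup>2 \<le> (cube_avg n u powr (q / 2))\<^sup>2"
      by (intro power_mono cube_avg_nonneg) auto
    then show ?thesis by (simp add: power2_eq_square flip: powr_add)
  qed
  ultimately have "cube_avg n (\<lambda>\<epsilon>. u \<epsilon> powr q) - cube_avg n u powr q \<le> energy n ?F ?F"
    using cube_poincare[of n ?F] by linarith
  then have "(q - 1) * (cube_avg n (\<lambda>\<epsilon>. u \<epsilon> powr q) - cube_avg n u powr q) \<le> (q - 1) * energy n ?F ?F"
    using q by (intro mult_left_mono) auto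
  also have "\<dots> \<le> energy n (\<lambda>\<epsilon>. u \<epsilon> powr (q - 1)) u"
    unfolding energy_def cube_avg_cmult[symmetric] sum_distrib_left
  proof (intro cube_avg_mono sum_mono)
    fix \<epsilon> i assume "\<epsilon> \<in> hypercube n" and i: "i \<in> {1..n}"
    then have pos': "0 < u \<epsilon>" "0 < u (flip i \<epsilon>)" using pos flip_in_hypercube by blast+
    show "(q - 1) * (discrete_deriv i ?F \<epsilon> * discrete_deriv i ?F \<epsilon>)
      \<le> discrete_deriv i (\<lambda>\<epsilon>. u \<epsilon> powr (q - 1)) \<epsilon> * discrete_deriv i u \<epsilon>"
      using powr_sq_diff_le'[OF q pos'(2) pos'(1)]
      by (simp add: discrete_deriv_def power2_eq_square mult_ac divide_right_mono)
  qed
  finally show ?thesis .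
qed

text \<open>Together with \<open>energy_noise\<close> this says that \<open>r\<close> times the derivative of the \<open>q\<close>-th moment is
  \<open>q\<close> times the energy between \<open>u powr (q - 1)\<close> and \<open>u = noise n r g\<close>.\<close>

lemma noise_moment_derivative:
  assumes pos: "\<And>\<epsilon>. \<epsilon> \<in> hypercube n \<Longrightarrow> 0 < noise n r g \<epsilon>"
  shows "((\<lambda>r. cube_avg n (\<lambda>\<epsilon>. noise n r g \<epsilon> powr q)) has_real_derivative
    q * noise_slope n r (\<lambda>\<epsilon>. noise n r g \<epsilon> powr (q - 1)) g) (at r)"
proof -
  have d: "((\<lambda>r. noise n r g \<epsilon>) has_real_derivative
      (\<Sum>A\<in>Pow {1..n}. real (card A) * r ^ (card A - 1) * (fourier_coeff n g A
          * walsh A \<epsilon>))) (at r)" for \<epsilon>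
    unfolding noise_walsh_expansion by (auto intro!: derivative_eq_intros sum.cong)
  have "((\<lambda>r. noise n r g \<epsilon> powr q) has_real_derivative
      q * noise n r g \<epsilon> powr (q - 1) * (\<Sum>A\<in>Pow {1..n}. real (card A) * r ^ (card A - 1)
          * (fourier_coeff n g A * walsh A \<epsilon>))) (at r)"
    if "\<epsilon> \<in> hypercube n" for \<epsilon>
    by (rule DERIV_chain2[OF has_real_derivative_powr[OF pos[OF that]] d])
  then have "((\<lambda>r. cube_avg n (\<lambda>\<epsilon>. noise n r g \<epsilon> powr q)) has_real_derivative
    cube_avg n (\<lambda>\<epsilon>. q * noise n r g \<epsilon> powr (q - 1) * (\<Sum>A\<in>Pow {1..n}. real (card A)
        * r ^ (card A - 1) * (fourier_coeff n g A * walsh A \<epsilon>)))) (at r)"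
    unfolding cube_avg_def by (intro DERIV_cdivide DERIV_sum) auto
  also have "cube_avg n (\<lambda>\<epsilon>. q * noise n r g \<epsilon> powr (q - 1) * (\<Sum>A\<in>Pow {1..n}. real (card A)
      * r ^ (card A - 1) * (fourier_coeff n g A * walsh A \<epsilon>)))
     = (\<Sum>A\<in>Pow {1..n}. cube_avg n (\<lambda>\<epsilon>. (q * (real (card A) * r ^ (card A - 1)
         * fourier_coeff n g A)) * (noise n r g \<epsilon> powr (q - 1) * walsh A \<epsilon>)))"
    unfolding cube_avg_sum[symmetric] sum_distrib_left by (intro cube_avg_cong sum.cong refl)
        (simp add: mult_ac)
  also have "\<dots> = q * noise_slope n r (\<lambda>\<epsilon>. noise n r g \<epsilon> powr (q - 1)) g"
    unfolding noise_slope_def cube_avg_cmult sum_distrib_left fourier_coeff_def[symmetric]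
    by (intro sum.cong refl) (simp add: mult_ac)
  finally show ?thesis .
qed

text \<open>The weights \<open>u powr (2 - q)\<close> and \<open>u powr (q - 2)\<close> are inverse to each other; the second one
  produces the energy of \<open>up_grad_energy\<close>, the first is handled by Hoelder in
  \<open>grad_weighted_Holder\<close>.\<close>

lemma energy_young:
  assumes pos: "\<And>\<epsilon>. \<epsilon> \<in> hypercube n \<Longrightarrow> 0 < u \<epsilon>" and l: "0 < l"
  shows "energy n f u \<le> l * cube_avg n (\<lambda>\<epsilon>. (grad_length n f \<epsilon>)\<^sup>2 * u \<epsilon> powr (2 - q))
    + cube_avg n (\<lambda>\<epsilon>. u \<epsilon> powr (q - 2) * up_grad_sq n u \<epsilon>) / l"
proof -
  have "2 * cube_avg n (\<lambda>\<epsilon>. \<Sum>i\<in>{1..n}. if u (flip i \<epsilon>) < u \<epsilon> then discrete_deriv i f \<epsilon>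
      * discrete_deriv i u \<epsilon> else 0)
    \<le> cube_avg n (\<lambda>\<epsilon>. l * ((grad_length n f \<epsilon>)\<^sup>2 * u \<epsilon> powr (2 - q)) + (1 / l) * (u \<epsilon> powr (q - 2)
        * up_grad_sq n u \<epsilon>))"
    unfolding cube_avg_cmult[symmetric]
  proof (rule cube_avg_mono)
    fix \<epsilon> assume e: "\<epsilon> \<in> hypercube n"
    define c where "c = l * u \<epsilon> powr (2 - q)"
    have c: "c > 0" using pos[OF e] l by (simp add: c_def)
    have c': "u \<epsilon> powr (q - 2) / l = 1 / c"
      using pos[OF e] l powr_minus_divide[of "u \<epsilon>" "2 - q"] by (simp add: c_def field_simps)
    have young: "2 * (a * b) \<le> c * a\<^sup>2 + (1 / c) * b\<^sup>2" for a b :: real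
    proof -
      have "0 \<le> (c * a - b)\<^sup>2 / c" using c by simp
      also have "\<dots> = c * a\<^sup>2 + (1 / c) * b\<^sup>2 - 2 * (a * b)"
        using c by (simp add: power2_eq_square field_simps)
      finally show ?thesis by simp
    qed
    \<comment> \<open>dropping the indicator from the \<open>f\<close>-part costs nothing; keeping it on the \<open>u\<close>-part is what
        makes \<open>u powr (q - 2)\<close> harmless\<close>
    have "2 * (\<Sum>i\<in>{1..n}. if u (flip i \<epsilon>) < u \<epsilon> then discrete_deriv i f \<epsilon> * discrete_deriv i u \<epsilon> else 0)
      \<le> (\<Sum>i\<in>{1..n}. c * (discrete_deriv i f \<epsilon>)\<^sup>2 + (1 / c) * (if u (flip i \<epsilon>) < u \<epsilon>
          then (discrete_deriv i u \<epsilon>)\<^sup>2 else 0))"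
      unfolding sum_distrib_left using c young by (intro sum_mono) auto
    also have "\<dots> = c * (grad_length n f \<epsilon>)\<^sup>2 + (1 / c) * up_grad_sq n u \<epsilon>"
      by (simp add: grad_length_sq up_grad_sq_def sum.distrib flip: sum_distrib_left sum_divide_distrib)
    also have "\<dots> = l * ((grad_length n f \<epsilon>)\<^sup>2 * u \<epsilon> powr (2 - q)) + (1 / l) * (u \<epsilon> powr (q - 2)
        * up_grad_sq n u \<epsilon>)"
      unfolding c'[symmetric] by (simp add: c_def)
    finally show "2 * (\<Sum>i\<in>{1..n}. if u (flip i \<epsilon>) < u \<epsilon> then discrete_deriv i f \<epsilon>
        * discrete_deriv i u \<epsilon> else 0)
      \<le> l * ((grad_length n f \<epsilon>)\<^sup>2 * u \<epsilon> powr (2 - q)) + (1 / l) * (u \<epsilon> powr (q - 2)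
          * up_grad_sq n u \<epsilon>)" .
  qed
  then show ?thesis unfolding energy_upward cube_avg_add cube_avg_cmult by simp
qed

text \<open>The exponents \<open>p / 2\<close> and \<open>q / (2 - q)\<close> are conjugate.\<close>

lemma grad_weighted_Holder:
  assumes p: "2 < p" and q: "1 / p + 1 / q = 1" and pos: "\<And>\<epsilon>. \<epsilon> \<in> hypercube n \<Longrightarrow> 0 < u \<epsilon>"
  shows "cube_avg n (\<lambda>\<epsilon>. (grad_length n f \<epsilon>)\<^sup>2 * u \<epsilon> powr (2 - q))
    \<le> (Lp_norm n p (grad_length n f))\<^sup>2 * Lp_norm n q u powr (2 - q)"
proof -
  have q1: "1 < q" using conjugate_exponent_gt_one[of p q] p q by simp
  have pq: "p + q = p * q" using p q1 q by (simp add: field_simps)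
  have q2: "q < 2" by (rule conjugate_exponent_lt_two[OF p q])
  have ex: "1 < p / 2" "1 < q / (2 - q)" "1 / (p / 2) + 1 / (q / (2 - q)) = 1"
    using p q1 q2 pq by (auto simp: field_simps)
  have "cube_avg n (\<lambda>\<epsilon>. (grad_length n f \<epsilon>)\<^sup>2 * u \<epsilon> powr (2 - q))
    \<le> Lp_norm n (p / 2) (\<lambda>\<epsilon>. (grad_length n f \<epsilon>)\<^sup>2) * Lp_norm n (q / (2 - q)) (\<lambda>\<epsilon>. u \<epsilon> powr (2 - q))"
    by (rule order_trans[OF abs_ge_self cube_Holder[OF ex]])
  also have "Lp_norm n (p / 2) (\<lambda>\<epsilon>. (grad_length n f \<epsilon>)\<^sup>2) = (Lp_norm n p (grad_length n f))\<^sup>2"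
  proof -
    have "\<bar>(grad_length n f \<epsilon>)\<^sup>2\<bar> powr (p / 2) = \<bar>grad_length n f \<epsilon>\<bar> powr p" for \<epsilon>
      using powr_powr[of "grad_length n f \<epsilon>" 2 "p / 2"] by simp
    then show ?thesis
      by (simp add: Lp_norm_real power2_eq_square flip: powr_add)
  qed
  also have "Lp_norm n (q / (2 - q)) (\<lambda>\<epsilon>. u \<epsilon> powr (2 - q)) = Lp_norm n q u powr (2 - q)"
  proof -
    have "cube_avg n (\<lambda>\<epsilon>. u \<epsilon> powr q) = cube_avg n (\<lambda>\<epsilon>. \<bar>u \<epsilon>\<bar> powr q)"
      using pos by (intro cube_avg_cong) (simp add: less_imp_le)
    then show ?thesis using q1 q2 by (simp add: Lp_norm_real powr_powr)
  qed
  finally show ?thesis .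
qed

section \<open>Removing noise for exponents above two\<close>

text \<open>A differential inequality of Cauchy-Schwarz type. Integrating \<open>split\<close> with a constant weight
  would give the divergent \<open>\<integral> dr / r\<close> at 0. The weight \<open>l * r powr k\<close> makes the first term
  integrable, and \<open>decay\<close>, which says that \<open>\<phi> r - \<phi> 0\<close> vanishes at rate \<open>r powr (2 * k)\<close>, keeps
  the second one bounded.\<close>

lemma weighted_path_bound:
  fixes \<psi> \<phi> \<psi>' \<phi>' :: "real \<Rightarrow> real"
  assumes d\<psi>: "\<And>r. 0 \<le> r \<Longrightarrow> r \<le> 1 \<Longrightarrow> (\<psi> has_real_derivative \<psi>' r) (at r)"
    and d\<phi>: "\<And>r. 0 \<le> r \<Longrightarrow> r \<le> 1 \<Longrightarrow> (\<phi> has_real_derivative \<phi>' r) (at r)"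
    and split: "\<And>r l. 0 < r \<Longrightarrow> r < 1 \<Longrightarrow> 0 < l \<Longrightarrow> r * \<psi>' r \<le> l * a + r * \<phi>' r / (4 * k * l)"
    and decay: "\<And>r. 0 < r \<Longrightarrow> r < 1 \<Longrightarrow> 2 * k * (\<phi> r - \<phi> 0) \<le> r * \<phi>' r"
    and k: "0 < k" "k \<le> 1" and s: "0 < s" "s \<le> 1" and l: "0 < l" and a: "0 \<le> a"
    and above: "\<phi> 0 \<le> \<phi> s"
  shows "\<psi> 1 - \<psi> s \<le> (l * a * (1 - s) + (\<phi> 1 - \<phi> 0) / (2 * l)) / k"
proof -
  \<comment> \<open>increasing, by \<open>split\<close> with weight \<open>l * r powr k\<close>; the decay of \<open>\<phi> - \<phi> 0\<close> pays for
      differentiating \<open>r powr (- k)\<close>\<close>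
  define M where "M = (\<lambda>r. l * a * r powr k / k + r powr (- k) * (\<phi> r - \<phi> 0) / (2 * k * l) - \<psi> r)"
  have dM: "(M has_real_derivative (l * a * r powr (k - 1)
      + (r powr (- k) * \<phi>' r - k * r powr (- k - 1) * (\<phi> r - \<phi> 0)) / (2 * k * l) - \<psi>' r)) (at r)"
    if "0 < r" "r \<le> 1" for r
    unfolding M_def using that k l
    by (auto intro!: derivative_eq_intros d\<psi> d\<phi> simp: field_simps)
  have "M s \<le> M 1"
  proof (rule DERIV_nonneg_imp_increasing_open[OF s(2)])
    fix r assume r: "s < r" "r < 1"
    then have r0: "0 < r" using s by simp
    define x where "x = r powr k"
    have x: "x > 0" using r0 by (simp add: x_def)
    have powers: "r powr (k - 1) = x / r" "r powr (- k) = 1 / x" "r powr (- k - 1) = 1 / x / r"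
      using r0 by (simp_all add: x_def powr_diff powr_minus_divide)
    define P where "P = r * \<phi>' r / (4 * k * (l * x))"
    have 1: "r * \<psi>' r \<le> l * x * a + P"
      using split[of r "l * x"] r0 r l x by (simp add: P_def)
    have "2 * k * (\<phi> r - \<phi> 0) / (4 * k * (l * x)) \<le> P"
      unfolding P_def using decay[of r] r0 r k l x by (intro divide_right_mono) auto
    moreover have "2 * k * (\<phi> r - \<phi> 0) / (4 * k * (l * x)) = (\<phi> r - \<phi> 0) / (2 * (l * x))"
      using k l x by (simp add: field_simps)
    ultimately have 2: "(\<phi> r - \<phi> 0) / (2 * (l * x)) \<le> P" by simp
    have "r * (l * a * r powr (k - 1)
      + (r powr (- k) * \<phi>' r - k * r powr (- k - 1) * (\<phi> r - \<phi> 0)) / (2 * k * l) - \<psi>' r)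
      = l * x * a + 2 * P - (\<phi> r - \<phi> 0) / (2 * (l * x)) - r * \<psi>' r"
      unfolding powers P_def using r0 k l x by (simp add: field_simps)
    then have "0 \<le> r * (l * a * r powr (k - 1)
      + (r powr (- k) * \<phi>' r - k * r powr (- k - 1) * (\<phi> r - \<phi> 0)) / (2 * k * l) - \<psi>' r)"
      using 1 2 by linarith
    then have "0 \<le> l * a * r powr (k - 1)
      + (r powr (- k) * \<phi>' r - k * r powr (- k - 1) * (\<phi> r - \<phi> 0)) / (2 * k * l) - \<psi>' r"
      using r0 by (simp add: zero_le_mult_iff)
    then show "\<exists>y. (M has_real_derivative y) (at r) \<and> 0 \<le> y"
      using dM[OF r0 less_imp_le[OF r(2)]] by blast
  next
    show "continuous_on {s..1} M"
    proof (intro continuous_at_imp_continuous_on ballI)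
      fix r assume "r \<in> {s..1}"
      then show "isCont M r" using s by (intro DERIV_isCont[OF dM]) auto
    qed
  qed
  then have "\<psi> 1 - \<psi> s \<le> l * a * (1 - s powr k) / k + (\<phi> 1 - \<phi> 0) / (2 * k * l) - s powr (- k)
      * (\<phi> s - \<phi> 0) / (2 * k * l)"
    by (simp add: M_def algebra_simps diff_divide_distrib)
  also have "\<dots> \<le> l * a * (1 - s) / k + (\<phi> 1 - \<phi> 0) / (2 * k * l)"
  proof -
    have "s powr 1 \<le> s powr k" using s k by (intro powr_mono') auto
    then have "l * a * (1 - s powr k) / k \<le> l * a * (1 - s) / k"
      using l a k s by (intro divide_right_mono mult_left_mono) auto
    moreover have "0 \<le> s powr (- k) * (\<phi> s - \<phi> 0) / (2 * k * l)"
      using above k l by (intro divide_nonneg_pos mult_nonneg_nonneg) auto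
    ultimately show ?thesis by linarith
  qed
  also have "\<dots> = (l * a * (1 - s) + (\<phi> 1 - \<phi> 0) / (2 * l)) / k"
    using k l by (simp add: field_simps)
  finally show ?thesis .
qed

text \<open>Applies \<open>weighted_path_bound\<close> to \<open>\<psi> r = E (f * u)\<close> and \<open>\<phi> r = E (u powr q)\<close> for
  \<open>u = noise n r g\<close>, with the weight parameter chosen to balance the two terms. The first term
  carries the factor \<open>1 - s\<close> and the second does not, which is why the optimum is of order
  \<open>sqrt (1 - s)\<close>.\<close>

lemma noise_increment_gt2_positive:
  assumes p: "2 < p" and pq: "1 / p + 1 / q = 1"
    and pos: "\<And>\<epsilon>. \<epsilon> \<in> hypercube n \<Longrightarrow> 0 < g \<epsilon>" and s: "0 < s" "s \<le> 1"
  shows "cube_avg n (\<lambda>\<epsilon>. f \<epsilon> * noise n 1 g \<epsilon>) - cube_avg n (\<lambda>\<epsilon>. f \<epsilon> * noise n s g \<epsilon>)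
    \<le> 4 / (q * (q - 1)) * (sqrt (1 - s) * Lp_norm n p (grad_length n f) * Lp_norm n q g)"
proof -
  have q: "1 < q" "q \<le> 2" "q < 2"
    using conjugate_exponent_gt_one[OF _ pq] conjugate_exponent_lt_two[OF p pq] p by auto
  \<comment> \<open>half the decay rate of \<open>\<phi> - \<phi> 0\<close> given by the Beckner inequality; it is at most 1 because
      \<open>q \<le> 2\<close>\<close>
  define k where "k = q * (q - 1) / 2"
  have k: "0 < k" "k \<le> 1"
  proof -
    have "q * (q - 1) \<le> 2 * 1" using q by (intro mult_mono) auto
    then show "0 < k" "k \<le> 1" using q by (auto simp: k_def)
  qed
  define X where "X = Lp_norm n p (grad_length n f)"
  define G where "G = Lp_norm n q g"
  define \<psi> where "\<psi> = (\<lambda>r. cube_avg n (\<lambda>\<epsilon>. f \<epsilon> * noise n r g \<epsilon>))"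
  define \<phi> where "\<phi> = (\<lambda>r. cube_avg n (\<lambda>\<epsilon>. noise n r g \<epsilon> powr q))"
  define \<psi>' where "\<psi>' = (\<lambda>r. noise_slope n r f g)"
  define \<phi>' where "\<phi>' = (\<lambda>r. q * noise_slope n r (\<lambda>\<epsilon>. noise n r g \<epsilon> powr (q - 1)) g)"
  have u: "0 < noise n r g \<epsilon>" if "0 \<le> r" "r \<le> 1" "\<epsilon> \<in> hypercube n" for r \<epsilon>
    by (rule noise_pos[OF pos that])
  have d\<psi>: "(\<psi> has_real_derivative \<psi>' r) (at r)" for r
    unfolding \<psi>_def \<psi>'_def by (rule noise_pairing_derivative)
  have d\<phi>: "(\<phi> has_real_derivative \<phi>' r) (at r)" if "0 \<le> r" "r \<le> 1" for r
    unfolding \<phi>_def \<phi>'_def by (rule noise_moment_derivative) (rule u[OF that])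
  have e\<psi>: "r * \<psi>' r = energy n f (noise n r g)" for r
    unfolding \<psi>'_def by (rule energy_noise[symmetric])
  have e\<phi>: "r * \<phi>' r = q * energy n (\<lambda>\<epsilon>. noise n r g \<epsilon> powr (q - 1)) (noise n r g)" for r
    unfolding \<phi>'_def energy_noise by simp
  have mono: "\<phi> r \<le> \<phi> t" if "0 \<le> r" "r \<le> t" "t \<le> 1" for r t
  proof (rule DERIV_nonneg_imp_increasing_open[OF that(2)])
    fix x assume x: "r < x" "x < t"
    have "0 \<le> x * \<phi>' x"
      unfolding e\<phi> using q x that by (intro mult_nonneg_nonneg energy_powr_nonneg u) auto
    then have "0 \<le> \<phi>' x" using x that by (simp add: zero_le_mult_iff)
    then show "\<exists>y. (\<phi> has_real_derivative y) (at x) \<and> 0 \<le> y"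
      using d\<phi>[of x] x that by auto
  next
    show "continuous_on {r..t} \<phi>"
    proof (intro continuous_at_imp_continuous_on ballI)
      fix x assume "x \<in> {r..t}"
      then show "isCont \<phi> x" using that by (intro DERIV_isCont[OF d\<phi>]) auto
    qed
  qed
  have norm_u: "Lp_norm n q (noise n r g) = \<phi> r powr (1 / q)" if "0 \<le> r" "r \<le> 1" for r
  proof -
    have "cube_avg n (\<lambda>\<epsilon>. \<bar>noise n r g \<epsilon>\<bar> powr q) = \<phi> r"
      unfolding \<phi>_def using u[OF that] by (intro cube_avg_cong) (simp add: less_imp_le)
    then show ?thesis by (simp add: Lp_norm_real)
  qed
  have \<phi>1: "\<phi> 1 = G powr q"
  proof -
    have "\<phi> 1 = cube_avg n (\<lambda>\<epsilon>. \<bar>g \<epsilon>\<bar> powr q)"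
      unfolding \<phi>_def using pos by (intro cube_avg_cong) (simp add: noise_one less_imp_le)
    then show ?thesis using q by (simp add: G_def Lp_norm_powr)
  qed
  have \<phi>0: "\<phi> 0 > 0"
  proof -
    have "hypercube n \<noteq> {}" using card_hypercube[of n] by auto
    then obtain \<epsilon> where "\<epsilon> \<in> hypercube n" by blast
    then have "0 < cube_avg n g" using u[of 0 \<epsilon>] by (simp add: noise_zero)
    then show ?thesis by (simp add: \<phi>_def noise_zero)
  qed
  have \<phi>_nonneg: "0 \<le> \<phi> r" for r by (simp add: \<phi>_def cube_avg_nonneg)
  have Gpos: "G > 0"
  proof -
    have "G powr q > 0" using \<phi>0 mono[of 0 1] \<phi>1 by linarith
    then have "G \<noteq> 0" by auto
    then show ?thesis using Lp_norm_nonneg[of n q g] unfolding G_def by linarith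
  qed
  define a where "a = X\<^sup>2 * G powr (2 - q)"
  have bound: "\<psi> 1 - \<psi> s \<le> (l * a * (1 - s) + (\<phi> 1 - \<phi> 0) / (2 * l)) / k" if l: "0 < l" for l
  proof (rule weighted_path_bound[where \<psi>' = \<psi>' and \<phi>' = \<phi>'])
    fix r m :: real assume r: "0 < r" "r < 1" and m: "0 < m"
    have ru: "0 < noise n r g \<epsilon>" if "\<epsilon> \<in> hypercube n" for \<epsilon> using u that r by simp
    have "r * \<psi>' r \<le> m * cube_avg n (\<lambda>\<epsilon>. (grad_length n f \<epsilon>)\<^sup>2 * noise n r g \<epsilon> powr (2 - q))
      + cube_avg n (\<lambda>\<epsilon>. noise n r g \<epsilon> powr (q - 2) * up_grad_sq n (noise n r g) \<epsilon>) / m"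
      unfolding e\<psi> by (rule energy_young[OF ru m])
    also have "\<dots> \<le> m * a + (r * \<phi>' r / (4 * k)) / m"
    proof (intro add_mono mult_left_mono divide_right_mono)
      have "Lp_norm n q (noise n r g) \<le> G"
      proof -
        have "\<phi> r powr (1 / q) \<le> \<phi> 1 powr (1 / q)"
          using mono[of r 1] r q \<phi>_nonneg by (intro powr_mono2) auto
        also have "\<dots> = G" using q Gpos by (simp add: \<phi>1 powr_powr)
        finally show ?thesis using norm_u r by simp
      qed
      then have "Lp_norm n q (noise n r g) powr (2 - q) \<le> G powr (2 - q)"
        using q by (intro powr_mono2) auto
      then have "X\<^sup>2 * Lp_norm n q (noise n r g) powr (2 - q) \<le> a"
        unfolding a_def by (intro mult_left_mono) auto
      moreover have "cube_avg n (\<lambda>\<epsilon>. (grad_length n f \<epsilon>)\<^sup>2 * noise n r g \<epsilon> powr (2 - q))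
          \<le> X\<^sup>2 * Lp_norm n q (noise n r g) powr (2 - q)"
        unfolding X_def by (rule grad_weighted_Holder[OF p pq ru])
      ultimately show "cube_avg n (\<lambda>\<epsilon>. (grad_length n f \<epsilon>)\<^sup>2 * noise n r g \<epsilon> powr (2 - q)) \<le> a"
        by linarith
    next
      have "2 * (q - 1) * cube_avg n (\<lambda>\<epsilon>. noise n r g \<epsilon> powr (q - 2) * up_grad_sq n (noise n r g) \<epsilon>)
        \<le> energy n (\<lambda>\<epsilon>. noise n r g \<epsilon> powr (q - 1)) (noise n r g)"
        by (rule up_grad_energy[OF q(1,2) ru])
      also have "\<dots> = r * \<phi>' r / q" using q by (simp add: e\<phi>)
      finally show "cube_avg n (\<lambda>\<epsilon>. noise n r g \<epsilon> powr (q - 2) * up_grad_sq n (noise n r g) \<epsilon>) \<le> r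
          * \<phi>' r / (4 * k)"
        using q by (simp add: k_def field_simps)
    qed (use m in auto)
    finally show "r * \<psi>' r \<le> m * a + r * \<phi>' r / (4 * k * m)" by simp
  next
    fix r :: real assume r: "0 < r" "r < 1"
    have ru: "0 < noise n r g \<epsilon>" if "\<epsilon> \<in> hypercube n" for \<epsilon> using u that r by simp
    have "cube_avg n (noise n r g) = cube_avg n g"
      using fourier_noise[of "{}" n r g] by (simp add: fourier_coeff_def walsh_def)
    then have \<phi>0_eq: "\<phi> 0 = cube_avg n (noise n r g) powr q" by (simp add: \<phi>_def noise_zero)
    have "(q - 1) * (\<phi> r - \<phi> 0) \<le> energy n (\<lambda>\<epsilon>. noise n r g \<epsilon> powr (q - 1)) (noise n r g)"
      unfolding \<phi>0_eq unfolding \<phi>_def by (rule cube_beckner[OF q(1,2) ru])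
    then have "q * ((q - 1) * (\<phi> r - \<phi> 0)) \<le> r * \<phi>' r"
      unfolding e\<phi> using q by (intro mult_left_mono) auto
    then show "2 * k * (\<phi> r - \<phi> 0) \<le> r * \<phi>' r" by (simp add: k_def mult.assoc)
  qed (use d\<psi> d\<phi> k s l mono in \<open>auto simp: a_def\<close>)
  \<comment> \<open>\<open>Y\<close> replaces \<open>sqrt (1 - s) * X\<close>, which may vanish, in the optimal choice of \<open>l\<close>\<close>
  have "\<psi> 1 - \<psi> s \<le> (2 / k * G) * Y" if Y: "sqrt (1 - s) * X < Y" for Y
  proof -
    have Y0: "Y > 0"
    proof -
      have "0 \<le> sqrt (1 - s) * X" using s by (simp add: X_def)
      then show ?thesis using Y by linarith
    qed
    define l where "l = G powr (q - 1) / Y"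
    have l: "l > 0" using Gpos Y0 by (simp add: l_def)
    have G1: "G powr (q - 1) * G powr (2 - q) = G" "G powr q = G powr (q - 1) * G"
      using Gpos powr_add[of G "q - 1" 1] by (simp_all flip: powr_add)
    have "X\<^sup>2 * (1 - s) \<le> Y\<^sup>2"
    proof -
      have "(sqrt (1 - s) * X)\<^sup>2 \<le> Y\<^sup>2"
        using Y s by (intro power_mono mult_nonneg_nonneg) (auto simp: X_def)
      then show ?thesis using s by (simp add: power_mult_distrib mult.commute)
    qed
    then have "(G powr (q - 1) * G powr (2 - q)) * (X\<^sup>2 * (1 - s)) / Y \<le> (G powr (q - 1)
        * G powr (2 - q)) * Y\<^sup>2 / Y"
      using Y0 by (intro divide_right_mono mult_left_mono) auto
    then have "l * a * (1 - s) \<le> G * Y"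
      using Y0 G1(1) by (simp add: l_def a_def power2_eq_square mult_ac)
    moreover have "(\<phi> 1 - \<phi> 0) / (2 * l) \<le> G powr q / (2 * l)"
      using \<phi>0 l by (intro divide_right_mono) (auto simp: \<phi>1)
    moreover have "G powr q / (2 * l) = G * Y / 2"
      using Gpos Y0 unfolding l_def G1(2) by (simp add: field_simps)
    ultimately have "l * a * (1 - s) + (\<phi> 1 - \<phi> 0) / (2 * l) \<le> 2 * (G * Y)"
      using mult_pos_pos[OF Gpos Y0] by linarith
    then have "(l * a * (1 - s) + (\<phi> 1 - \<phi> 0) / (2 * l)) / k \<le> 2 * (G * Y) / k"
      using k by (intro divide_right_mono) auto
    then show ?thesis using bound[OF l] by simp
  qed
  then have "\<psi> 1 - \<psi> s \<le> (2 / k * G) * (sqrt (1 - s) * X)"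
    by (rule le_mult_if_le_mult_greater) (use Gpos k in auto)
  also have "2 / k * G * (sqrt (1 - s) * X) = 4 / (q * (q - 1)) * (sqrt (1 - s) * X * G)"
    using q by (simp add: k_def)
  finally show ?thesis by (simp add: \<psi>_def X_def G_def)
qed

lemma Lp_norm_grad_uminus: "Lp_norm n p (grad_length n (\<lambda>\<epsilon>. - f \<epsilon>)) = Lp_norm n p (grad_length n f)"
proof -
  have "(discrete_deriv i (\<lambda>\<epsilon>. - f \<epsilon>) \<epsilon>)\<^sup>2 = (discrete_deriv i f \<epsilon>)\<^sup>2" for i \<epsilon>
    by (simp add: discrete_deriv_def power2_commute power_divide)
  then have "grad_length n (\<lambda>\<epsilon>. - f \<epsilon>) = grad_length n f"
    by (intro ext) (simp add: grad_length_def)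
  then show ?thesis by simp
qed

text \<open>Stated with a crude constant; used for the shifted positive and negative parts of \<open>g\<close>.\<close>

lemma Lp_norm_shifted_part:
  fixes g h :: "(nat \<Rightarrow> real) \<Rightarrow> real"
  assumes q: "1 \<le> q" and y: "Lp_norm n q g < y"
    and h: "\<And>\<epsilon>. 0 \<le> h \<epsilon>" "\<And>\<epsilon>. h \<epsilon> \<le> \<bar>g \<epsilon>\<bar>"
  shows "Lp_norm n q (\<lambda>\<epsilon>. h \<epsilon> + y) \<le> 4 * y"
proof -
  have y0: "0 < y" using y Lp_norm_nonneg[of n q g] by linarith
  have "cube_avg n (\<lambda>\<epsilon>. \<bar>h \<epsilon> + y\<bar> powr q) \<le> cube_avg n (\<lambda>\<epsilon>. 2 powr q * (\<bar>g \<epsilon>\<bar> powr q + y powr q))"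
  proof (rule cube_avg_mono)
    fix \<epsilon>
    have "\<bar>h \<epsilon> + y\<bar> powr q \<le> (\<bar>g \<epsilon>\<bar> + y) powr q"
      using h[of \<epsilon>] y0 q by (intro powr_mono2) auto
    also have "\<dots> \<le> 2 powr q * (\<bar>g \<epsilon>\<bar> powr q + y powr q)"
      using y0 q by (intro powr_add_le) auto
    finally show "\<bar>h \<epsilon> + y\<bar> powr q \<le> 2 powr q * (\<bar>g \<epsilon>\<bar> powr q + y powr q)" .
  qed
  also have "\<dots> = 2 powr q * (Lp_norm n q g powr q + y powr q)"
    using q by (simp add: cube_avg_cmult cube_avg_add Lp_norm_powr)
  also have "\<dots> \<le> 2 powr q * (y powr q + y powr q)"
    using y q by (intro mult_left_mono add_right_mono powr_mono2) auto
  also have "\<dots> \<le> 2 powr q * (2 powr q * y powr q)"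
    using powr_mono[of 1 q 2] q mult_right_mono[of 2 "2 powr q" "y powr q"]
    by (intro mult_left_mono) auto
  also have "\<dots> = (4 * y) powr q"
  proof -
    have "4 powr q = 2 powr q * 2 powr q" using powr_mult[of 2 2 q] by simp
    then show ?thesis using y0 by (simp add: powr_mult)
  qed
  finally have "Lp_norm n q (\<lambda>\<epsilon>. h \<epsilon> + y) \<le> ((4 * y) powr q) powr (1 / q)"
    unfolding Lp_norm_real using q by (intro powr_mono2 cube_avg_nonneg) auto
  then show ?thesis using q y0 by (simp add: powr_powr)
qed

lemma noise_increment_gt2:
  assumes p: "2 < p" and pq: "1 / p + 1 / q = 1" and s: "0 < s" "s \<le> 1"
  shows "cube_avg n (\<lambda>\<epsilon>. f \<epsilon> * noise n 1 g \<epsilon>) - cube_avg n (\<lambda>\<epsilon>. f \<epsilon> * noise n s g \<epsilon>)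
    \<le> 32 / (q * (q - 1)) * sqrt (1 - s) * Lp_norm n p (grad_length n f) * Lp_norm n q g"
proof -
  have q: "1 < q" using conjugate_exponent_gt_one[OF _ pq] p by simp
  define X where "X = sqrt (1 - s) * Lp_norm n p (grad_length n f)"
  define c where "c = 4 / (q * (q - 1))"
  have c0: "0 \<le> c" using q by (simp add: c_def)
  have X0: "0 \<le> X" using s by (simp add: X_def)
  define inc where "inc = (\<lambda>f g. cube_avg n (\<lambda>\<epsilon>. f \<epsilon> * noise n 1 g \<epsilon>) - cube_avg n (\<lambda>\<epsilon>. f \<epsilon>
      * noise n s g \<epsilon>))"
  have "inc f g \<le> (8 * c * X) * y" if y: "Lp_norm n q g < y" for y
  proof -
    have y0: "0 < y" using y Lp_norm_nonneg[of n q g] by linarith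
    \<comment> \<open>the shift by \<open>y\<close> makes both parts strictly positive and cancels in their difference;
        taking it of the size of the norm of \<open>g\<close> costs only a constant\<close>
    define gp where "gp = (\<lambda>\<epsilon>. max (g \<epsilon>) 0 + y)"
    define gm where "gm = (\<lambda>\<epsilon>. max (- g \<epsilon>) 0 + y)"
    have le: "inc h k \<le> c * (X * (4 * y))"
      if "Lp_norm n p (grad_length n h) = Lp_norm n p (grad_length n f)"
        "\<And>\<epsilon>. 0 < k \<epsilon>" "Lp_norm n q k \<le> 4 * y" for h k
    proof -
      have "inc h k \<le> c * (sqrt (1 - s) * Lp_norm n p (grad_length n h) * Lp_norm n q k)"
        unfolding inc_def c_def using that(2) by (intro noise_increment_gt2_positive p pq s)
      also have "\<dots> \<le> c * (X * (4 * y))"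
        unfolding X_def that(1) using c0 s that(3) by (intro mult_left_mono) auto
      finally show ?thesis .
    qed
    have "g = (\<lambda>\<epsilon>. gp \<epsilon> - gm \<epsilon>)" by (auto simp: gp_def gm_def max_def)
    then have "inc f g = inc f (\<lambda>\<epsilon>. gp \<epsilon> - gm \<epsilon>)" by simp
    also have "\<dots> = inc f gp + inc (\<lambda>\<epsilon>. - f \<epsilon>) gm"
      by (simp add: inc_def noise_diff right_diff_distrib cube_avg_diff cube_avg_cmult[of n "-1",
          simplified])
    also have "\<dots> \<le> c * (X * (4 * y)) + c * (X * (4 * y))"
      using y0 q y by (intro add_mono le Lp_norm_grad_uminus refl)
        (auto simp: gp_def gm_def max_def intro!: Lp_norm_shifted_part[where g = g] add_nonneg_pos)
    finally show ?thesis by (simp add: algebra_simps)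
  qed
  then have "inc f g \<le> (8 * c * X) * Lp_norm n q g"
    by (rule le_mult_if_le_mult_greater) (use c0 X0 in auto)
  then show ?thesis by (simp add: inc_def c_def X_def mult_ac)
qed

text \<open>Removing noise of size \<open>1 - s\<close> changes a function by at most the order of \<open>sqrt (1 - s)\<close>
  times its gradient, stated in dual form. The constant depends on \<open>p\<close> alone, not on the
  dimension.\<close>

lemma noise_increment:
  assumes p: "1 < p" and pq: "1 / p + 1 / q = 1"
  shows "\<exists>C>0. \<forall>n f g s. 0 < s \<longrightarrow> s \<le> 1 \<longrightarrow>
    cube_avg n (\<lambda>\<epsilon>. f \<epsilon> * g \<epsilon>) - cube_avg n (\<lambda>\<epsilon>. f \<epsilon> * noise n s g \<epsilon>)
      \<le> C * sqrt (1 - s) * Lp_norm n p (grad_length n f) * Lp_norm n q g"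
proof -
  have q: "1 < q" using conjugate_exponent_gt_one[OF p pq] .
  have one: "cube_avg n (\<lambda>\<epsilon>. f \<epsilon> * noise n 1 g \<epsilon>) = cube_avg n (\<lambda>\<epsilon>. f \<epsilon> * g \<epsilon>)" for n f g
    by (intro cube_avg_cong) (simp add: noise_one)
  show ?thesis
  proof (cases "p \<le> 2")
    case True
    then show ?thesis
      using noise_increment_le2[OF p True pq, unfolded one] by (intro exI[of _ 2]) auto
  next
    case False
    then have "2 < p" by simp
    then show ?thesis
      using noise_increment_gt2[OF _ pq, unfolded one] q
      by (intro exI[of _ "32 / (q * (q - 1))"]) auto
  qed
qed

section \<open>Extrapolating polynomials with a zero of high order\<close>

lemma lagrange_interpolation:
  fixes P :: "real poly"
  assumes deg: "degree P \<le> m" and inj: "inj_on x {..m}"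
  shows "poly P t = (\<Sum>j\<le>m. poly P (x j) * (\<Prod>i\<in>{..m} - {j}. (t - x i) / (x j - x i)))"
proof -
  define L where "L = (\<Sum>j\<le>m. smult (poly P (x j)) (\<Prod>i\<in>{..m} - {j}. [:- x i / (x j - x i), 1 / (x j -
      x i):]))"
  have lin: "poly [:- x i / (x j - x i), 1 / (x j - x i):] t = (t - x i) / (x j - x i)" for i j t
    by (simp add: diff_divide_distrib)
  have poly_L: "poly L t = (\<Sum>j\<le>m. poly P (x j) * (\<Prod>i\<in>{..m} - {j}. (t - x i) / (x j - x i)))" for t
    by (simp only: L_def poly_sum poly_smult poly_prod lin)
  have "degree L \<le> m"
    unfolding L_def
  proof (intro degree_sum_le)
    fix j assume j: "j \<in> {..m}"
    have "degree (\<Prod>i\<in>{..m} - {j}. [:- x i / (x j - x i), 1 / (x j - x i):])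
        \<le> (\<Sum>i\<in>{..m} - {j}. degree [:- x i / (x j - x i), 1 / (x j - x i):])"
      using degree_prod_sum_le[of "{..m} - {j}" "\<lambda>i. [:- x i / (x j - x i), 1 / (x j - x i):]"] by
          (simp add: o_def)
    also have "\<dots> \<le> (\<Sum>i\<in>{..m} - {j}. 1)" by (intro sum_mono) auto
    also have "\<dots> = m" using j by simp
    finally show "degree (smult (poly P (x j)) (\<Prod>i\<in>{..m} - {j}. [:- x i / (x j - x i), 1 / (x j - x
        i):])) \<le> m"
      using degree_smult_le order_trans by blast
  qed auto
  moreover have "card (x ` {..m}) = Suc m" using inj by (simp add: card_image)
  moreover have "poly P t = poly L t" if t: "t \<in> x ` {..m}" for t
  proof -
    from t obtain k where k: "k \<le> m" "t = x k" by auto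
    have "(\<Prod>i\<in>{..m} - {j}. (t - x i) / (x j - x i)) = of_bool (j = k)" if j: "j \<le> m" for j
    proof (cases "j = k")
      case True
      have "(\<Prod>i\<in>{..m} - {j}. (t - x i) / (x j - x i)) = (\<Prod>i\<in>{..m} - {j}. 1)"
        using True k j inj by (intro prod.cong) (auto simp: inj_on_def)
      then show ?thesis using True by simp
    next
      case False
      then show ?thesis using k by (auto intro!: prod_zero bexI[of _ k])
    qed
    then have "poly L t = (\<Sum>j\<le>m. poly P (x j) * of_bool (j = k))"
      unfolding poly_L by (intro sum.cong) auto
    also have "\<dots> = poly P t" using k by (simp add: of_bool_def if_distrib[of "\<lambda>x. _ * x"] cong: if_cong)
    finally show ?thesis by simp
  qed
  ultimately have "P = L"
    using deg by (intro poly_eqI_degree[of "x ` {..m}"]) auto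
  then show ?thesis using poly_L by metis
qed

lemma prod_distance_fact:
  assumes "j \<le> m"
  shows "(\<Prod>i\<in>{..m} - {j}. \<bar>real i - real j\<bar>) = fact j * fact (m - j)"
proof -
  have split: "{..m} - {j} = {..<j} \<union> {j<..m}" using assms by auto
  have "(\<Prod>i\<in>{..m} - {j}. \<bar>real i - real j\<bar>)
      = (\<Prod>i<j. \<bar>real i - real j\<bar>) * (\<Prod>i\<in>{j<..m}. \<bar>real i - real j\<bar>)"
    unfolding split by (rule prod.union_disjoint) auto
  also have "(\<Prod>i<j. \<bar>real i - real j\<bar>) = (\<Prod>i\<in>{1..j}. real i)"
    by (rule prod.reindex_bij_witness[of _ "\<lambda>i. j - i" "\<lambda>i. j - i"]) auto
  also have "(\<Prod>i\<in>{j<..m}. \<bar>real i - real j\<bar>) = (\<Prod>i\<in>{1..m-j}. real i)"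
    by (rule prod.reindex_bij_witness[of _ "\<lambda>i. i + j" "\<lambda>i. i - j"]) auto
  finally show ?thesis by (simp add: fact_prod)
qed

text \<open>One term of the exponential series.\<close>

lemma power_over_fact_le_exp: "real m ^ m / fact m \<le> exp (real m)"
proof -
  have sums: "(\<lambda>k. real m ^ k / fact k) sums exp (real m)"
    using exp_converges[of "real m"] by (simp add: divide_inverse mult.commute)
  have "(\<Sum>k\<in>{m}. real m ^ k / fact k) \<le> (\<Sum>k. real m ^ k / fact k)"
    using sums by (intro sum_le_suminf) (auto simp: sums_iff)
  then show ?thesis using sums by (simp add: sums_iff)
qed

text \<open>A polynomial of degree \<open>m\<close> can grow at distance of order \<open>m / d\<close> from an interval of that
  length only by a factor exponential in \<open>m\<close>, while \<open>r ^ d\<close> decays there exponentially in \<open>m\<close> at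
  an adjustable rate. The constant 8 is large enough for the decay to win.\<close>

lemma polynomial_extrapolation:
  fixes P :: "real poly" and M :: real
  assumes m: "1 \<le> m" and d: "8 * m \<le> d" and deg: "degree P \<le> m"
    and bound: "\<And>r. 0 \<le> r \<Longrightarrow> r \<le> 1 \<Longrightarrow> \<bar>r ^ d * poly P r\<bar> \<le> M"
  shows "\<bar>(1 - 8 * real m / real d) ^ d * poly P (1 - 8 * real m / real d)\<bar> \<le> M / 2"
proof -
  define s where "s = 1 - 8 * real m / real d"
  \<comment> \<open>these nodes lie so close to 1 that removing \<open>r ^ d\<close> from the bound costs only \<open>exp (2 * m)\<close>\<close>
  define x where "x = (\<lambda>j. 1 - real j / real d)"
  have d0: "real d > 0" using m d by simp
  have s0: "0 \<le> s" using d d0 by (simp add: s_def divide_le_eq_1)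
  have M0: "0 \<le> M" using bound[of 0] by linarith
  have inj: "inj_on x {..m}" using d0 by (auto simp: inj_on_def x_def)
  have s_pow: "s ^ d \<le> exp (- 8 * real m)"
  proof -
    have "s \<le> exp (- 8 * real m / real d)"
      using exp_ge_add_one_self[of "- 8 * real m / real d"] by (simp add: s_def)
    then have "s ^ d \<le> exp (- 8 * real m / real d) ^ d" using s0 by (intro power_mono)
    also have "\<dots> = exp (- 8 * real m)" using d0 by (simp flip: exp_of_nat_mult)
    finally show ?thesis .
  qed
  have node: "\<bar>poly P (x j)\<bar> \<le> M * exp (2 * real m)" if j: "j \<le> m" for j
  proof -
    define y where "y = real j / real d"
    have xj: "x j = 1 - y" by (simp add: x_def y_def)
    have y: "0 \<le> y" "y \<le> 1 / 2" using j d d0 by (auto simp: y_def field_simps)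
    have "1 \<le> (1 - y) * (1 + 2 * y)"
    proof -
      have "0 \<le> y * (1 - 2 * y)" using y by (intro mult_nonneg_nonneg) auto
      then show ?thesis by (simp add: algebra_simps)
    qed
    also have "\<dots> \<le> (1 - y) * exp (2 * y)" using y by (intro mult_left_mono exp_ge_add_one_self) auto
    finally have "1 ^ d \<le> ((1 - y) * exp (2 * y)) ^ d" by (intro power_mono) auto
    also have "\<dots> = (1 - y) ^ d * exp (2 * real j)"
      using d0 by (simp add: power_mult_distrib y_def flip: exp_of_nat_mult)
    also have "\<dots> \<le> (1 - y) ^ d * exp (2 * real m)" using y j by (intro mult_left_mono) auto
    finally have "1 * \<bar>poly P (x j)\<bar> \<le> ((1 - y) ^ d * exp (2 * real m)) * \<bar>poly P (x j)\<bar>"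
      by (intro mult_right_mono) auto
    also have "\<dots> = exp (2 * real m) * \<bar>x j ^ d * poly P (x j)\<bar>"
    proof -
      have "0 \<le> (1 - y) ^ d" using y by (intro zero_le_power) simp
      then show ?thesis by (simp add: abs_mult xj)
    qed
    also have "\<dots> \<le> exp (2 * real m) * M"
      unfolding xj using y by (intro mult_left_mono bound) auto
    finally show ?thesis by (simp add: mult.commute)
  qed
  have weight: "\<bar>\<Prod>i\<in>{..m} - {j}. (s - x i) / (x j - x i)\<bar> \<le> (8 * real m) ^ m / fact m
      * real (m choose j)"
    if j: "j \<le> m" for j
  proof -
    have "\<bar>\<Prod>i\<in>{..m} - {j}. (s - x i) / (x j - x i)\<bar> = (\<Prod>i\<in>{..m} - {j}. (8
        * real m - real i) / \<bar>real i - real j\<bar>)"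
      unfolding abs_prod
    proof (intro prod.cong refl)
      fix i assume i: "i \<in> {..m} - {j}"
      have e: "s - x i = - ((8 * real m - real i) / real d)" "x j - x i = (real i - real j) / real d"
        using d0 by (simp_all add: s_def x_def field_simps)
      show "\<bar>(s - x i) / (x j - x i)\<bar> = (8 * real m - real i) / \<bar>real i - real j\<bar>"
        unfolding e using d0 i by (simp add: abs_divide)
    qed
    also have "\<dots> = (\<Prod>i\<in>{..m} - {j}. 8 * real m - real i) / (fact j * fact (m - j))"
      by (simp only: prod_dividef prod_distance_fact[OF j])
    also have "\<dots> \<le> (\<Prod>i\<in>{..m} - {j}. 8 * real m) / (fact j * fact (m - j))"
      by (intro divide_right_mono prod_mono) auto
    also have "\<dots> = (8 * real m) ^ m / fact m * real (m choose j)"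
      using j by (simp add: binomial_fact)
    finally show ?thesis .
  qed
  have "\<bar>poly P s\<bar> \<le> (\<Sum>j\<le>m. \<bar>poly P (x j)\<bar> * \<bar>\<Prod>i\<in>{..m} - {j}. (s - x i) / (x j - x i)\<bar>)"
    unfolding lagrange_interpolation[OF deg inj, of s] abs_mult[symmetric] by (rule sum_abs)
  also have "\<dots> \<le> (\<Sum>j\<le>m. (M * exp (2 * real m)) * ((8 * real m) ^ m / fact m * real (m choose j)))"
    using M0 by (intro sum_mono mult_mono node weight) auto
  also have "\<dots> = (M * exp (2 * real m)) * ((8 * real m) ^ m / fact m * real (\<Sum>j\<le>m. m choose j))"
    by (simp add: sum_distrib_left)
  also have "\<dots> = (M * exp (2 * real m)) * (16 ^ m * (real m ^ m / fact m))"
  proof -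
    have "real (\<Sum>j\<le>m. m choose j) = 2 ^ m" by (simp add: choose_row_sum)
    moreover have "(16::real) ^ m = 8 ^ m * 2 ^ m" by (simp flip: power_mult_distrib)
    ultimately show ?thesis by (simp add: power_mult_distrib)
  qed
  also have "\<dots> \<le> (M * exp (2 * real m)) * (16 ^ m * exp (real m))"
    using M0 by (intro mult_left_mono power_over_fact_le_exp) auto
  finally have "s ^ d * \<bar>poly P s\<bar> \<le> exp (- 8 * real m) * ((M * exp (2 * real m)) * (16 ^ m
      * exp (real m)))"
    using s_pow s0 by (intro mult_mono) auto
  \<comment> \<open>16 is 8 times the 2 of the binomial sum; the exponent collects \<open>- 8 + 2 + 1\<close>\<close>
  also have "\<dots> = M * (16 ^ m * exp (- 5 * real m))"
    by (simp add: exp_add[symmetric] mult_ac)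
  also have "\<dots> \<le> M * (1 / 2)"
  proof (intro mult_left_mono M0)
    have "(2::real) ^ 5 \<le> exp 1 ^ 5" using exp_ge_add_one_self[of 1] by (intro power_mono) auto
    then have "32 \<le> exp (5::real)" by (simp flip: exp_of_nat_mult)
    then have "exp (- 5) \<le> (1 / 32 :: real)" by (simp add: exp_minus field_simps)
    then have "(16 * exp (- 5)) ^ m \<le> (1 / 2 :: real) ^ m" by (intro power_mono) auto
    also have "\<dots> \<le> (1 / 2) ^ 1" using m by (intro power_decreasing) auto
    also have "(16 * exp (- 5)) ^ m = 16 ^ m * exp (- 5 * real m)"
      by (simp add: power_mult_distrib mult.commute flip: exp_of_nat_mult)
    finally show "16 ^ m * exp (- 5 * real m) \<le> 1 / 2" by simp
  qed
  finally show ?thesis using s0 by (simp add: abs_mult flip: s_def)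
qed

section \<open>Lower bounds for the gradient on a spectral band\<close>

text \<open>The case of equality in Hoelder: \<open>g\<close> norms \<open>f\<close>.\<close>

lemma duality_witness:
  fixes f :: "(nat \<Rightarrow> real) \<Rightarrow> real"
  assumes p: "1 < p" and pq: "1 / p + 1 / q = 1"
  defines "g \<equiv> \<lambda>\<epsilon>. sgn (f \<epsilon>) * \<bar>f \<epsilon>\<bar> powr (p - 1)"
  shows "cube_avg n (\<lambda>\<epsilon>. f \<epsilon> * g \<epsilon>) = Lp_norm n p f powr p"
    and "Lp_norm n q g = Lp_norm n p f powr (p - 1)"
proof -
  have q: "1 < q" using conjugate_exponent_gt_one[OF p pq] .
  have pq': "(p - 1) * q = p" using p q pq by (simp add: field_simps)
  have "f \<epsilon> * g \<epsilon> = \<bar>f \<epsilon>\<bar> powr p" for \<epsilon>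
  proof -
    have "f \<epsilon> * g \<epsilon> = \<bar>f \<epsilon>\<bar> * \<bar>f \<epsilon>\<bar> powr (p - 1)" by (simp add: g_def abs_sgn mult.assoc)
    also have "\<dots> = \<bar>f \<epsilon>\<bar> powr p"
      by (cases "f \<epsilon> = 0") (simp_all add: powr_diff)
    finally show ?thesis .
  qed
  then show "cube_avg n (\<lambda>\<epsilon>. f \<epsilon> * g \<epsilon>) = Lp_norm n p f powr p"
    using p by (simp add: Lp_norm_powr)
  have "\<bar>g \<epsilon>\<bar> powr q = \<bar>f \<epsilon>\<bar> powr p" for \<epsilon>
    by (cases "f \<epsilon> = 0") (simp_all add: g_def abs_mult powr_powr pq' abs_sgn_eq)
  then have "Lp_norm n q g = cube_avg n (\<lambda>\<epsilon>. \<bar>f \<epsilon>\<bar> powr p) powr (1 / q)"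
    by (simp add: Lp_norm_real)
  also have "\<dots> = Lp_norm n p f powr (p - 1)"
  proof -
    have "1 / q = 1 / p * (p - 1)" using p q pq by (simp add: field_simps)
    then show ?thesis by (simp add: Lp_norm_real powr_powr)
  qed
  finally show "Lp_norm n q g = Lp_norm n p f powr (p - 1)" .
qed

lemma band_limited_pairing_polynomial:
  assumes spectrum: "\<forall>A\<subseteq>{1..n}. fourier_coeff n f A \<noteq> 0 \<longrightarrow> d \<le> card A \<and> card A \<le> d + m"
  shows "\<exists>P :: real poly. degree P \<le> m \<and>
    (\<forall>r. cube_avg n (\<lambda>\<epsilon>. f \<epsilon> * noise n r g \<epsilon>) = r ^ d * poly P r)"
proof (intro exI conjI allI)
  define B where "B = {A \<in> Pow {1..n}. d \<le> card A \<and> card A \<le> d + m}"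
  define P where "P = (\<Sum>A\<in>B. monom (fourier_coeff n f A * fourier_coeff n g A) (card A - d))"
  have finB: "finite B" by (simp add: B_def)
  show "degree P \<le> m"
    unfolding P_def
    by (intro degree_sum_le finB order_trans[OF degree_monom_le]) (auto simp: B_def)
  fix r
  show "cube_avg n (\<lambda>\<epsilon>. f \<epsilon> * noise n r g \<epsilon>) = r ^ d * poly P r"
  proof -
    have "cube_avg n (\<lambda>\<epsilon>. f \<epsilon> * noise n r g \<epsilon>) = (\<Sum>A\<in>B. r ^ card A * (fourier_coeff n f A
        * fourier_coeff n g A))"
      unfolding cube_avg_noise
      by (rule sum.mono_neutral_right) (use spectrum in \<open>auto simp: B_def\<close>)
    also have "\<dots> = r ^ d * poly P r"
      unfolding P_def poly_sum sum_distrib_left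
      by (intro sum.cong refl) (auto simp: B_def poly_monom mult_ac simp flip: power_add)
    finally show ?thesis .
  qed
qed

text \<open>Pairing \<open>f\<close> with its norming function \<open>g\<close>, at least half of \<open>E (f * g)\<close> is lost between
  \<open>r = 1\<close> and \<open>r = 1 - 8 * m / d\<close>, or \<open>r = 0\<close> if that is negative, and \<open>noise_increment\<close> says what
  such a loss costs in terms of the gradient.\<close>

theorem reverse_gradient_bound_real:
  fixes p :: real
  assumes p: "1 < p"
  shows "\<exists>C>0. \<forall>n d m f. 1 \<le> d \<longrightarrow> 1 \<le> m \<longrightarrow>
    (\<forall>A\<subseteq>{1..n}. fourier_coeff n f A \<noteq> 0 \<longrightarrow> d \<le> card A \<and> card A \<le> d + m) \<longrightarrow>
    Lp_norm n p f \<le> C * sqrt (real m / real d) * Lp_norm n p (grad_length n f)"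
proof -
  define q where "q = p / (p - 1)"
  have pq: "1 / p + 1 / q = 1" using p by (simp add: q_def field_simps)
  have q: "1 < q" using conjugate_exponent_gt_one[OF p pq] .
  obtain C where C: "0 < C" and incr: "\<And>n f g s. 0 < s \<Longrightarrow> s \<le> 1 \<Longrightarrow>
      cube_avg n (\<lambda>\<epsilon>. f \<epsilon> * g \<epsilon>) - cube_avg n (\<lambda>\<epsilon>. f \<epsilon> * noise n s g \<epsilon>)
        \<le> C * sqrt (1 - s) * Lp_norm n p (grad_length n f) * Lp_norm n q g"
    using noise_increment[OF p pq] by blast
  show ?thesis
  proof (intro exI[of _ "2 * C * sqrt 8"] conjI allI impI)
    show "0 < 2 * C * sqrt 8" using C by simp
  next
    fix n d m :: nat and f :: "(nat \<Rightarrow> real) \<Rightarrow> real"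
    assume d: "1 \<le> d" and m: "1 \<le> m"
      and spectrum: "\<forall>A\<subseteq>{1..n}. fourier_coeff n f A \<noteq> 0 \<longrightarrow> d \<le> card A \<and> card A \<le> d + m"
    define N where "N = Lp_norm n p f"
    define X where "X = Lp_norm n p (grad_length n f)"
    define g where "g = (\<lambda>\<epsilon>. sgn (f \<epsilon>) * \<bar>f \<epsilon>\<bar> powr (p - 1))"
    define \<psi> where "\<psi> = (\<lambda>r. cube_avg n (\<lambda>\<epsilon>. f \<epsilon> * noise n r g \<epsilon>))"
    have fg: "cube_avg n (\<lambda>\<epsilon>. f \<epsilon> * g \<epsilon>) = N powr p" "Lp_norm n q g = N powr (p - 1)"
      unfolding N_def g_def by (rule duality_witness[OF p pq])+
    obtain P where P: "degree P \<le> m" "\<And>r. \<psi> r = r ^ d * poly P r"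
      using band_limited_pairing_polynomial[OF spectrum, of g] unfolding \<psi>_def by blast
    have X0: "0 \<le> X" and N0: "0 \<le> N" by (simp_all add: X_def N_def)
    have NN: "N * N powr (p - 1) = N powr p"
      using N0 by (cases "N = 0") (simp_all add: powr_diff)
    have inc: "N powr p - \<psi> s \<le> C * sqrt (1 - s) * X * N powr (p - 1)" if "0 < s" "s \<le> 1" for s
      using incr[OF that, of n f g] by (simp add: fg \<psi>_def X_def)
    define K where "K = C * sqrt (8 * (real m / real d)) * X * N powr (p - 1)"
    have K0: "0 \<le> K" using C X0 by (simp add: K_def)
    have "N powr p \<le> 2 * K"
    \<comment> \<open>either \<open>s = 1 - 8 * m / d\<close> is positive, or \<open>m / d\<close> is bounded below and \<open>s\<close> may tend to 0,
        where \<open>\<psi>\<close> vanishes\<close>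
    proof (cases "8 * m < d")
      case True
      define s where "s = 1 - 8 * real m / real d"
      have s: "0 < s" "s \<le> 1" using True by (auto simp: s_def divide_simps)
      have "\<bar>\<psi> s\<bar> \<le> N powr p / 2"
        unfolding P(2) s_def
      proof (rule polynomial_extrapolation[OF m _ P(1)])
        show "\<bar>r ^ d * poly P r\<bar> \<le> N powr p" if "0 \<le> r" "r \<le> 1" for r
          using noise_Holder[OF p q pq that, of n f g]
          by (simp only: fg NN P(2)[symmetric] N_def[symmetric] \<psi>_def)
      qed (use True in simp)
      moreover have "N powr p - \<psi> s \<le> K"
        using inc[OF s] by (simp add: K_def s_def)
      ultimately show ?thesis by linarith
    next
      case False
      have "N powr p - K \<le> \<psi> s" if s: "0 < s" "s \<le> 1" for s
      proof -
        have "1 \<le> 8 * (real m / real d)" using False d by (simp add: divide_simps)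
        then have "sqrt (1 - s) \<le> sqrt (8 * (real m / real d))" using s
            by (intro real_sqrt_le_mono) linarith
        then have "C * sqrt (1 - s) * X * N powr (p - 1) \<le> K"
          unfolding K_def using C X0 by (intro mult_right_mono mult_left_mono) auto
        then show ?thesis using inc[OF s] by linarith
      qed
      then have "\<forall>\<^sub>F s in at_right 0. N powr p - K \<le> \<psi> s"
        unfolding eventually_at_right_field by (intro exI[of _ 1]) auto
      moreover have "(\<psi> \<longlongrightarrow> \<psi> 0) (at_right 0)"
        unfolding P(2)[abs_def] by (intro tendsto_intros)
      ultimately have "N powr p - K \<le> \<psi> 0"
        by (intro tendsto_lowerbound[of \<psi> "\<psi> 0" "at_right 0"]) auto
      also have "\<psi> 0 = 0" using d by (simp add: P(2))
      finally have "N powr p - K \<le> 0" .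
      then show ?thesis using K0 by linarith
    qed
    have "N \<le> 2 * C * sqrt 8 * sqrt (real m / real d) * X"
    proof (cases "N = 0")
      case True
      then show ?thesis using C X0 by simp
    next
      case False
      then have "0 < N powr (p - 1)" using N0 by simp
      moreover have "N * N powr (p - 1) \<le> (2 * C * sqrt 8 * sqrt (real m / real d) * X)
          * N powr (p - 1)"
        using \<open>N powr p \<le> 2 * K\<close> unfolding NN K_def real_sqrt_mult by (simp add: mult_ac)
      ultimately show ?thesis by (rule mult_right_le_imp_le[rotated])
    qed
    then show "Lp_norm n p f \<le> 2 * C * sqrt 8 * sqrt (real m / real d) * Lp_norm n p (grad_length n f)"
      by (simp only: N_def X_def)
  qed
qed

text \<open>Reduces complex functions to real ones; the loss of a constant factor is harmless.\<close>

lemma Lp_norm_complex_le: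
  fixes f :: "(nat \<Rightarrow> real) \<Rightarrow> complex"
  assumes p: "1 \<le> p"
    and B: "Lp_norm n p (\<lambda>\<epsilon>. Re (f \<epsilon>)) \<le> B" "Lp_norm n p (\<lambda>\<epsilon>. Im (f \<epsilon>)) \<le> B"
  shows "Lp_norm n p f \<le> 4 * B"
proof -
  have B0: "0 \<le> B" using B(1) Lp_norm_nonneg[of n p "\<lambda>\<epsilon>. Re (f \<epsilon>)"] by linarith
  have "cube_avg n (\<lambda>\<epsilon>. cmod (f \<epsilon>) powr p) \<le> cube_avg n (\<lambda>\<epsilon>. 2 powr p * (\<bar>Re (f \<epsilon>)\<bar> powr p
      + \<bar>Im (f \<epsilon>)\<bar> powr p))"
  proof (rule cube_avg_mono)
    fix \<epsilon>
    have "cmod (f \<epsilon>) powr p \<le> (\<bar>Re (f \<epsilon>)\<bar> + \<bar>Im (f \<epsilon>)\<bar>) powr p"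
      using p by (intro powr_mono2 cmod_le) auto
    also have "\<dots> \<le> 2 powr p * (\<bar>Re (f \<epsilon>)\<bar> powr p + \<bar>Im (f \<epsilon>)\<bar> powr p)"
      using p by (intro powr_add_le) auto
    finally show "cmod (f \<epsilon>) powr p \<le> 2 powr p * (\<bar>Re (f \<epsilon>)\<bar> powr p + \<bar>Im (f \<epsilon>)\<bar> powr p)" .
  qed
  also have "\<dots> = 2 powr p * (Lp_norm n p (\<lambda>\<epsilon>. Re (f \<epsilon>)) powr p + Lp_norm n p (\<lambda>\<epsilon>. Im (f \<epsilon>)) powr p)"
    using p by (simp add: cube_avg_cmult cube_avg_add Lp_norm_powr)
  also have "\<dots> \<le> 2 powr p * (B powr p + B powr p)"
    using B p by (intro mult_left_mono add_mono powr_mono2) auto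
  also have "\<dots> \<le> 2 powr p * (2 powr p * B powr p)"
    using powr_mono[of 1 p 2] p mult_right_mono[of 2 "2 powr p" "B powr p"]
    by (intro mult_left_mono) auto
  also have "\<dots> = (4 * B) powr p"
  proof -
    have "4 powr p = 2 powr p * 2 powr p" using powr_mult[of 2 2 p] by simp
    then show ?thesis using B0 by (simp add: powr_mult)
  qed
  finally have "cube_avg n (\<lambda>\<epsilon>. cmod (f \<epsilon>) powr p) powr (1 / p) \<le> ((4 * B) powr p) powr (1 / p)"
    using p by (intro powr_mono2 cube_avg_nonneg) auto
  then show ?thesis using p B0 by (simp add: Lp_norm_def cube_avg_def powr_powr)
qed

text \<open>Applied to the real and to the imaginary part.\<close>

lemma Lp_norm_grad_le_complex:
  fixes f :: "(nat \<Rightarrow> real) \<Rightarrow> complex" and part :: "complex \<Rightarrow> real"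
  assumes p: "0 < p" and lin: "\<And>z w. part (z - w) = part z - part w" "\<And>z. part (z / 2) = part z / 2"
    and le: "\<And>z. \<bar>part z\<bar> \<le> cmod z"
  shows "Lp_norm n p (grad_length n (\<lambda>\<epsilon>. part (f \<epsilon>))) \<le> grad_Lp_norm n p f"
proof -
  have "grad_length n (\<lambda>\<epsilon>. part (f \<epsilon>)) \<epsilon> \<le> sqrt (\<Sum>i\<in>{1..n}. (cmod (partial_deriv i f \<epsilon>))\<^sup>2)" for \<epsilon>
  proof -
    have "discrete_deriv i (\<lambda>\<epsilon>. part (f \<epsilon>)) \<epsilon> = part (partial_deriv i f \<epsilon>)" for i
      by (simp add: discrete_deriv_def partial_deriv_def flip_def lin)
    then show ?thesis
      unfolding grad_length_def
      by (intro real_sqrt_le_mono sum_mono) (simp add: abs_le_square_iff[symmetric] le)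
  qed
  then have "cube_avg n (\<lambda>\<epsilon>. \<bar>grad_length n (\<lambda>\<epsilon>. part (f \<epsilon>)) \<epsilon>\<bar> powr p) \<le>
      cube_avg n (\<lambda>\<epsilon>. \<bar>sqrt (\<Sum>i\<in>{1..n}. (cmod (partial_deriv i f \<epsilon>))\<^sup>2)\<bar> powr p)"
    using p by (intro cube_avg_mono powr_mono2) (auto simp: sum_nonneg)
  then show ?thesis
    unfolding grad_Lp_norm_def Lp_norm_real using p by (intro powr_mono2 cube_avg_nonneg) auto
qed

theorem theorem17:
  fixes p :: real
  assumes "1 < p"
  shows "\<exists>c>0. \<forall>(n::nat) (d::nat) (m::nat) (f :: (nat \<Rightarrow> real) \<Rightarrow> complex).
    n \<ge> 1 \<longrightarrow> d \<ge> 1 \<longrightarrow> m \<ge> 1 \<longrightarrow> d + m \<le> n \<longrightarrow>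
    degree_at_most n (d + m) f \<longrightarrow> in_tail_space n d f \<longrightarrow>
    grad_Lp_norm n p f \<ge> c * sqrt (real d / real m) * Lp_norm n p f"
proof -
  obtain C where C: "0 < C" and real_bound: "\<forall>n d m f. 1 \<le> d \<longrightarrow> 1 \<le> m \<longrightarrow>
      (\<forall>A\<subseteq>{1..n}. fourier_coeff n f A \<noteq> 0 \<longrightarrow> d \<le> card A \<and> card A \<le> d + m) \<longrightarrow>
      Lp_norm n p f \<le> C * sqrt (real m / real d) * Lp_norm n p (grad_length n f)"
    using reverse_gradient_bound_real[OF assms] by blast
  have "1 / (4 * C) * sqrt (real d / real m) * Lp_norm n p f \<le> grad_Lp_norm n p f"
    if dm: "1 \<le> d" "1 \<le> m" and deg: "degree_at_most n (d + m) f" and tail: "in_tail_space n d f"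
    for n d m and f :: "(nat \<Rightarrow> real) \<Rightarrow> complex"
  proof -
    define B where "B = C * sqrt (real m / real d) * grad_Lp_norm n p f"
    have fourier: "fourier_coeff n (\<lambda>\<epsilon>. Re (f \<epsilon>)) A = Re (walsh_coeff n f A)"
      "fourier_coeff n (\<lambda>\<epsilon>. Im (f \<epsilon>)) A = Im (walsh_coeff n f A)" for A
    proof -
      have "(2::complex) ^ n = of_real (2 ^ n)" by simp
      then show "fourier_coeff n (\<lambda>\<epsilon>. Re (f \<epsilon>)) A = Re (walsh_coeff n f A)"
        "fourier_coeff n (\<lambda>\<epsilon>. Im (f \<epsilon>)) A = Im (walsh_coeff n f A)"
        unfolding fourier_coeff_def cube_avg_def walsh_coeff_def
        by (simp_all only: Re_divide_of_real Im_divide_of_real) simp_all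
    qed
    have spectrum: "d \<le> card A \<and> card A \<le> d + m" if "A \<subseteq> {1..n}" "walsh_coeff n f A \<noteq> 0" for A
      using that deg tail by (auto simp: degree_at_most_def in_tail_space_def not_less[symmetric])
    have "Lp_norm n p f \<le> 4 * B"
    proof (rule Lp_norm_complex_le)
      have "Lp_norm n p (\<lambda>\<epsilon>. Re (f \<epsilon>)) \<le> C * sqrt (real m / real d)
          * Lp_norm n p (grad_length n (\<lambda>\<epsilon>. Re (f \<epsilon>)))"
      proof (rule real_bound[rule_format, OF dm])
        fix A assume "A \<subseteq> {1..n}" "fourier_coeff n (\<lambda>\<epsilon>. Re (f \<epsilon>)) A \<noteq> 0"
        then show "d \<le> card A \<and> card A \<le> d + m"
          using fourier(1)[of A] by (intro spectrum) auto
      qed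
      also have "\<dots> \<le> B" unfolding B_def
        using C assms by (intro mult_left_mono Lp_norm_grad_le_complex) (auto simp: abs_Re_le_cmod)
      finally show "Lp_norm n p (\<lambda>\<epsilon>. Re (f \<epsilon>)) \<le> B" .
      have "Lp_norm n p (\<lambda>\<epsilon>. Im (f \<epsilon>)) \<le> C * sqrt (real m / real d)
          * Lp_norm n p (grad_length n (\<lambda>\<epsilon>. Im (f \<epsilon>)))"
      proof (rule real_bound[rule_format, OF dm])
        fix A assume "A \<subseteq> {1..n}" "fourier_coeff n (\<lambda>\<epsilon>. Im (f \<epsilon>)) A \<noteq> 0"
        then show "d \<le> card A \<and> card A \<le> d + m"
          using fourier(2)[of A] by (intro spectrum) auto
      qed
      also have "\<dots> \<le> B" unfolding B_def
        using C assms by (intro mult_left_mono Lp_norm_grad_le_complex) (auto simp: abs_Im_le_cmod)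
      finally show "Lp_norm n p (\<lambda>\<epsilon>. Im (f \<epsilon>)) \<le> B" .
    qed (use assms in simp)
    then have "1 / (4 * C) * sqrt (real d / real m) * Lp_norm n p f \<le> 1 / (4 * C)
        * sqrt (real d / real m) * (4 * B)"
      using C by (intro mult_left_mono) auto
    also have "\<dots> = (sqrt (real d / real m) * sqrt (real m / real d)) * grad_Lp_norm n p f"
      using C by (simp add: B_def)
    also have "sqrt (real d / real m) * sqrt (real m / real d) = 1"
      using dm by (simp flip: real_sqrt_mult)
    finally show ?thesis by simp
  qed
  moreover have "0 < 1 / (4 * C)" using C by simp
  ultimately show ?thesis by blast
qed

end
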